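(* Let $\Omega\subset\mathbb{R}^N$ be a bounded domain with smooth boundary $\partial\Omega$, and let $a>0$, $b>0$, $\alpha\in[0,\infty)$, $\beta\in(0,\infty)$, $\gamma\in[2,\infty)$. Let $(u_1,u_2)$ and $(v_1,v_2)$ be two positive solutions of $$\begin{cases} -\Delta u_1 = u_1u_2-bu_1, & x\in\Omega,\\ -\Delta u_2 = a u_1, & x\in\Omega,\\ \partial_\nu u_1+\alpha u_1=\partial_\nu u_2+\beta|u_2|^{\gamma-2}u_2=0, & x\in\partial\Omega,\end{cases}$$ satisfying $u_1\le v_1$ in $\Omega$ or $u_2\le v_2$ in $\Omega$. Then $u_1\equiv v_1$ and $u_2\equiv v_2$.
   Context: $\nu$ is the unit outward normal on $\partial\Omega$ and $\partial_\nu u=\nabla u\cdot\nu$. A solution is a pair of real-valued functions $u_1,u_2\in H^1(\Omega)\cap C(\overline\Omega)$ satisfying the problem in the weak sense, i.e. for all $\psi\in H^1(\Omega)$, $\int_\Omega\nabla u_1\cdot\nabla\psi\,dx+\alpha\int_{\partial\Omega}u_1\psi\,dS=\int_\Omega(u_1u_2-bu_1)\psi\,dx$ and $\int_\Omega\nabla u_2\cdot\nabla\psi\,dx+\beta\int_{\partial\Omega}|u_2|^{\gamma-2}u_2\psi\,dS=a\int_\Omega u_1\psi\,dx$. A solution is positive if $u_1>0$ and $u_2>0$ in $\Omega$. *)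

theory Defs
  imports "HOL-Analysis.Analysis"
begin

primrec Ck :: "nat \<Rightarrow> ('a::real_normed_vector \<Rightarrow> real) \<Rightarrow> bool" where
  "Ck 0 f \<longleftrightarrow> continuous_on UNIV f"
| "Ck (Suc k) f \<longleftrightarrow> (\<forall>x. f differentiable (at x)) \<and>
     (\<forall>v. Ck k (\<lambda>x. frechet_derivative f (at x) v))"

definition smooth :: "('a::real_normed_vector \<Rightarrow> real) \<Rightarrow> bool" where
  "smooth f \<longleftrightarrow> (\<forall>k. Ck k f)"

definition test_function :: "'a::euclidean_space set \<Rightarrow> ('a \<Rightarrow> real) \<Rightarrow> bool" where
  "test_function \<Omega> \<phi> \<longleftrightarrow>
     smooth \<phi> \<and> compact (closure {x. \<phi> x \<noteq> 0}) \<and> closure {x. \<phi> x \<noteq> 0} \<subseteq> \<Omega>"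

text \<open>Near each of its points the boundary is the graph of a smooth function over a hyperplane
  and the domain lies strictly on one side of it. The unit vector \<open>e\<close> is the
  "vertical" direction after reorienting the axes; \<open>x - (x \<bullet> e) *\<^sub>R e\<close> is the orthogonal
  projection of \<open>x\<close> to the hyperplane, so only the values of \<open>h\<close> on that hyperplane matter.\<close>

definition smooth_boundary :: "'a::euclidean_space set \<Rightarrow> bool" where
  "smooth_boundary \<Omega> \<longleftrightarrow>
     (\<forall>p\<in>frontier \<Omega>. \<exists>r>0. \<exists>e h. norm e = 1 \<and> smooth h \<and>
        \<Omega> \<inter> ball p r = {x \<in> ball p r. h (x - (x \<bullet> e) *\<^sub>R e) < x \<bullet> e})"

definition smooth_bounded_domain :: "'a::euclidean_space set \<Rightarrow> bool" where
  "smooth_bounded_domain \<Omega> \<longleftrightarrow>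
     open \<Omega> \<and> connected \<Omega> \<and> \<Omega> \<noteq> {} \<and> bounded \<Omega> \<and> smooth_boundary \<Omega>"

text \<open>The \<open>d\<close>-dimensional Hausdorff measure, normalised to agree with Lebesgue measure
  when \<open>d\<close> is the dimension of the space. The empty set is treated separately because
  \<open>0 ^ 0 = 1\<close>; for \<open>d = 0\<close> one gets the counting measure. Boundedness is required because
  \<^const>\<open>diameter\<close> is meaningless on unbounded sets.\<close>

definition hausdorff_weight :: "nat \<Rightarrow> 'a::euclidean_space set \<Rightarrow> ennreal" where
  "hausdorff_weight d C =
     (if C = {} then 0 else ennreal (unit_ball_vol (real d) * (diameter C / 2) ^ d))"

definition hausdorff_premeasure :: "nat \<Rightarrow> real \<Rightarrow> 'a::euclidean_space set \<Rightarrow> ennreal" where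
  "hausdorff_premeasure d \<delta> A =
     (INF C \<in> {C :: nat \<Rightarrow> 'a set. (\<forall>i. bounded (C i) \<and> diameter (C i) \<le> \<delta>) \<and> A \<subseteq> (\<Union>i. C i)}.
        \<Sum>i. hausdorff_weight d (C i))"

definition hausdorff_outer_measure :: "nat \<Rightarrow> 'a::euclidean_space set \<Rightarrow> ennreal" where
  "hausdorff_outer_measure d A = (SUP \<delta>\<in>{0<..}. hausdorff_premeasure d \<delta> A)"

definition hausdorff_measure :: "nat \<Rightarrow> 'a::euclidean_space measure" where
  "hausdorff_measure d = measure_of UNIV (sets borel) (hausdorff_outer_measure d)"

definition surface_measure :: "'a::euclidean_space set \<Rightarrow> 'a measure" where
  "surface_measure \<Omega> = restrict_space (hausdorff_measure (DIM('a) - 1)) (frontier \<Omega>)"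

definition square_integrable :: "'a measure \<Rightarrow> ('a \<Rightarrow> 'b::euclidean_space) \<Rightarrow> bool" where
  "square_integrable M f \<longleftrightarrow> f \<in> borel_measurable M \<and> integrable M (\<lambda>x. (norm (f x))\<^sup>2)"

definition L2_converges ::
    "'a measure \<Rightarrow> (nat \<Rightarrow> 'a \<Rightarrow> 'b::euclidean_space) \<Rightarrow> ('a \<Rightarrow> 'b) \<Rightarrow> bool" where
  "L2_converges M f g \<longleftrightarrow>
     (\<forall>k. square_integrable M (f k)) \<and> square_integrable M g \<and>
     (\<lambda>k. LINT x|M. (norm (f k x - g x))\<^sup>2) \<longlonglongrightarrow> 0"

text \<open>\<open>H1_gradient \<Omega> u G\<close>: \<open>u\<close> lies in the Sobolev space \<open>H\<^sup>1\<close> of \<open>\<Omega>\<close> and \<open>G\<close> is (a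
  representative of) its weak gradient. Functions are total; only their values on \<open>\<Omega>\<close> (up to
  null sets) matter here.\<close>

definition H1_gradient ::
    "'a::euclidean_space set \<Rightarrow> ('a \<Rightarrow> real) \<Rightarrow> ('a \<Rightarrow> 'a) \<Rightarrow> bool" where
  "H1_gradient \<Omega> u G \<longleftrightarrow>
     square_integrable (lebesgue_on \<Omega>) u \<and> square_integrable (lebesgue_on \<Omega>) G \<and>
     (\<forall>\<phi>. test_function \<Omega> \<phi> \<longrightarrow> (\<forall>i\<in>Basis.
        (LINT x|lebesgue_on \<Omega>. u x * frechet_derivative \<phi> (at x) i) =
        - (LINT x|lebesgue_on \<Omega>. (G x \<bullet> i) * \<phi> x)))"

text \<open>The boundary trace of an \<open>H\<^sup>1\<close> function is the continuous extension to \<open>H\<^sup>1\<close>, with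
  values in \<open>L\<^sup>2\<close> of the boundary, of the restriction map defined on those \<open>H\<^sup>1\<close> functions
  that are continuous up to the boundary. It is given as a relation, because \<open>\<tau>\<close> is only
  determined up to surface null sets.\<close>

definition has_trace ::
    "'a::euclidean_space set \<Rightarrow> ('a \<Rightarrow> real) \<Rightarrow> ('a \<Rightarrow> real) \<Rightarrow> bool" where
  "has_trace \<Omega> \<psi> \<tau> \<longleftrightarrow>
     (\<exists>G. H1_gradient \<Omega> \<psi> G \<and>
       (\<exists>f F. (\<forall>k. H1_gradient \<Omega> (f k) (F k) \<and> continuous_on (closure \<Omega>) (f k)) \<and>
          L2_converges (lebesgue_on \<Omega>) f \<psi> \<and>
          L2_converges (lebesgue_on \<Omega>) F G \<and>
          L2_converges (surface_measure \<Omega>) f \<tau>))"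

text \<open>Weak solutions. Weak gradients and traces are unique almost everywhere, so it does not
  matter which representatives are used. For \<open>\<gamma> = 2\<close> and \<open>u\<^sub>2 = 0\<close> the term
  \<open>\<bar>u\<^sub>2\<bar> powr (\<gamma> - 2) * u\<^sub>2\<close> is \<open>0\<close>, as it should be, whatever the value of \<open>0 powr 0\<close>.\<close>

definition weak_solution ::
    "'a::euclidean_space set \<Rightarrow> real \<Rightarrow> real \<Rightarrow> real \<Rightarrow> real \<Rightarrow> real \<Rightarrow>
      ('a \<Rightarrow> real) \<Rightarrow> ('a \<Rightarrow> real) \<Rightarrow> bool" where
  "weak_solution \<Omega> a b \<alpha> \<beta> \<gamma> u\<^sub>1 u\<^sub>2 \<longleftrightarrow>
     continuous_on (closure \<Omega>) u\<^sub>1 \<and> continuous_on (closure \<Omega>) u\<^sub>2 \<and>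
     (\<exists>G\<^sub>1 G\<^sub>2. H1_gradient \<Omega> u\<^sub>1 G\<^sub>1 \<and> H1_gradient \<Omega> u\<^sub>2 G\<^sub>2 \<and>
       (\<forall>\<psi> G \<tau>. H1_gradient \<Omega> \<psi> G \<and> has_trace \<Omega> \<psi> \<tau> \<longrightarrow>
         (LINT x|lebesgue_on \<Omega>. G\<^sub>1 x \<bullet> G x) + \<alpha> * (LINT x|surface_measure \<Omega>. u\<^sub>1 x * \<tau> x)
           = (LINT x|lebesgue_on \<Omega>. (u\<^sub>1 x * u\<^sub>2 x - b * u\<^sub>1 x) * \<psi> x) \<and>
         (LINT x|lebesgue_on \<Omega>. G\<^sub>2 x \<bullet> G x)
             + \<beta> * (LINT x|surface_measure \<Omega>. \<bar>u\<^sub>2 x\<bar> powr (\<gamma> - 2) * u\<^sub>2 x * \<tau> x)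
           = a * (LINT x|lebesgue_on \<Omega>. u\<^sub>1 x * \<psi> x)))"

definition positive_solution ::
    "'a::euclidean_space set \<Rightarrow> real \<Rightarrow> real \<Rightarrow> real \<Rightarrow> real \<Rightarrow> real \<Rightarrow>
      ('a \<Rightarrow> real) \<Rightarrow> ('a \<Rightarrow> real) \<Rightarrow> bool" where
  "positive_solution \<Omega> a b \<alpha> \<beta> \<gamma> u\<^sub>1 u\<^sub>2 \<longleftrightarrow>
     weak_solution \<Omega> a b \<alpha> \<beta> \<gamma> u\<^sub>1 u\<^sub>2 \<and> (\<forall>x\<in>\<Omega>. u\<^sub>1 x > 0 \<and> u\<^sub>2 x > 0)"

end

theory Submission
  imports Defs
begin

text \<open>Testing the first equation for \<open>u\<^sub>1\<close> with \<open>v\<^sub>1\<close> and conversely, and subtracting, gives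
  \<open>\<integral> u\<^sub>1 v\<^sub>1 (u\<^sub>2 - v\<^sub>2) = 0\<close>. If \<open>u\<^sub>2 \<le> v\<^sub>2\<close> this forces \<open>u\<^sub>2 = v\<^sub>2\<close>, and then the second equations
  force \<open>u\<^sub>1 = v\<^sub>1\<close>.

  If \<open>u\<^sub>1 \<le> v\<^sub>1\<close>, put \<open>w = u\<^sub>2 - v\<^sub>2\<close> and test the difference of the second equations with
  \<open>\<psi> = (max 0 w)\<^sup>2\<close>: monotonicity of the boundary nonlinearity shows that \<open>\<psi>\<close> has weak gradient \<open>0\<close>.
  Instead of concluding that \<open>\<psi>\<close> is constant, one repeats the symmetric argument with the test
  functions \<open>\<psi> v\<^sub>1\<close> and \<open>\<psi> u\<^sub>1\<close>, which gives \<open>\<integral> u\<^sub>1 v\<^sub>1 \<psi> w = 0\<close>, hence \<open>w \<le> 0\<close>, and the first case applies.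

  Two tools are needed: the chain rule for weak gradients of functions that are continuous up to
  the boundary, and finiteness of the surface measure, without which such functions need
  not have a trace.\<close>

subsection \<open>Smooth functions and test functions\<close>

text \<open>The solutions are only continuous up to the boundary with square integrable weak
  gradients, so no derivative of \<open>w\<close> is ever taken pointwise. The chain rule puts
  derivatives on the test function, moves shifts between factors by translation invariance, and
  obtains smooth weights by approximation. This works for \<Phi> of class C^1, which is why the
  positive part is squared: (max 0 t)^2 has the continuous derivative 2 max 0 t, while max 0 t has a
  kink.

  If \<open>u\<^sub>1 \<le> v\<^sub>1\<close>, the source term and the boundary term push in the
  same direction, so the integral of 2 max(0, w) |grad w|^2 is at most 0. A continuous \<psi> with
  zero weak gradient behaves like a constant in the product rule: \<psi> times
  \<open>u\<^sub>1\<close> has gradient \<psi> times that of \<open>u\<^sub>1\<close>. The weight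
  \<psi> therefore preserves the symmetry of the first equations. Its gain is a sign: w itself may
  change sign, but \<psi> w = (max 0 w)^3 does not, so the vanishing integral can be read pointwise.

  For the surface measure an upper bound is enough: grid cells on local graphs are counted, and no
  area formula enters.\<close>

lemma Ck_continuous: "Ck k f \<Longrightarrow> continuous_on UNIV f"
  by (cases k) (auto simp: differentiable_imp_continuous_within continuous_on_eq_continuous_within)

lemma Ck_Suc_imp: "Ck (Suc k) f \<Longrightarrow> Ck k f"
proof (induction k arbitrary: f)
  case 0
  then show ?case using Ck_continuous by fastforce
next
  case (Suc k)
  show ?case unfolding Ck.simps(2)[of k]
    using Suc.prems Suc.IH unfolding Ck.simps(2)[of "Suc k"] by blast
qed

lemma Ck_const: "Ck k (\<lambda>x. c)"
  by (induction k arbitrary: c) (auto simp: frechet_derivative_const)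

lemma Ck_bounded_linear:
  assumes "bounded_linear f" shows "Ck k f"
proof (cases k)
  case 0
  then show ?thesis using assms by (simp add: linear_continuous_on)
next
  case (Suc n)
  have "frechet_derivative f (at x) = f" for x
    using assms bounded_linear_imp_has_derivative frechet_derivative_at by metis
  then show ?thesis using Suc assms
    by (auto simp: Ck_const bounded_linear_imp_differentiable)
qed

lemma Ck_add: "Ck k f \<Longrightarrow> Ck k g \<Longrightarrow> Ck k (\<lambda>x. f x + g x)"
proof (induction k arbitrary: f g)
  case 0
  then show ?case by (auto intro: continuous_on_add)
next
  case (Suc k)
  have "frechet_derivative (\<lambda>x. f x + g x) (at x) v
      = frechet_derivative f (at x) v + frechet_derivative g (at x) v" for x v
  proof -
    have "((\<lambda>x. f x + g x) has_derivative
       (\<lambda>v. frechet_derivative f (at x) v + frechet_derivative g (at x) v)) (at x)"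
      using Suc.prems by (auto intro!: has_derivative_add simp: frechet_derivative_works)
    then show ?thesis by (metis frechet_derivative_at)
  qed
  then show ?case using Suc by simp
qed

lemma Ck_mult: "Ck k f \<Longrightarrow> Ck k g \<Longrightarrow> Ck k (\<lambda>x. f x * g x)"
proof (induction k arbitrary: f g)
  case 0
  then show ?case by (auto intro: continuous_on_mult)
next
  case (Suc k)
  have "frechet_derivative (\<lambda>x. f x * g x) (at x) v
      = f x * frechet_derivative g (at x) v + frechet_derivative f (at x) v * g x" for x v
  proof -
    have "((\<lambda>x. f x * g x) has_derivative
       (\<lambda>v. f x * frechet_derivative g (at x) v + frechet_derivative f (at x) v * g x)) (at x)"
      using Suc.prems by (auto intro!: has_derivative_mult simp: frechet_derivative_works)
    then show ?thesis by (metis frechet_derivative_at)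
  qed
  moreover have "Ck k f" "Ck k g" using Suc.prems Ck_Suc_imp by blast+
  ultimately show ?case using Suc.IH Suc.prems by (simp add: Ck_add)
qed

lemma has_derivative_shift:
  fixes f :: "'a::real_normed_vector \<Rightarrow> real"
  assumes "f differentiable (at (x + c))"
  shows "((\<lambda>x. f (x + c)) has_derivative frechet_derivative f (at (x + c))) (at x)"
proof -
  have "((\<lambda>x. x + c) has_derivative (\<lambda>v. v)) (at x)"
    by (auto intro!: derivative_eq_intros)
  moreover have "(f has_derivative frechet_derivative f (at (x + c))) (at (x + c))"
    using assms by (simp add: frechet_derivative_works)
  ultimately show ?thesis by (rule has_derivative_compose)
qed

lemma Ck_shift: "Ck k f \<Longrightarrow> Ck k (\<lambda>x. f (x + c))"
proof (induction k arbitrary: f)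
  case 0
  then show ?case
    unfolding Ck.simps(1)
    by (rule continuous_on_compose2[of UNIV f UNIV "\<lambda>x. x + c"]) (auto intro: continuous_intros)
next
  case (Suc k)
  have d: "((\<lambda>x. f (x + c)) has_derivative frechet_derivative f (at (x + c))) (at x)" for x
    using Suc.prems by (intro has_derivative_shift) simp
  have "frechet_derivative (\<lambda>x. f (x + c)) (at x) = frechet_derivative f (at (x + c))" for x
    using frechet_derivative_at[OF d] by simp
  moreover have "(\<lambda>x. f (x + c)) differentiable (at x)" for x
    using d differentiable_def by blast
  ultimately show ?case using Suc.IH[of "\<lambda>x. frechet_derivative f (at x) v" for v] Suc.prems
    by simp
qed

lemma Ck_real_polynomial_function: "real_polynomial_function p \<Longrightarrow> Ck k p"
  by (induction rule: real_polynomial_function.induct)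
     (simp_all add: Ck_add Ck_mult Ck_const Ck_bounded_linear)

lemma smooth_differentiable: "smooth f \<Longrightarrow> f differentiable (at x)"
  unfolding smooth_def using Ck.simps(2) by blast

lemma smooth_continuous: "smooth f \<Longrightarrow> continuous_on UNIV f"
  unfolding smooth_def using Ck_continuous by blast

lemma smooth_derivative: "smooth f \<Longrightarrow> smooth (\<lambda>x. frechet_derivative f (at x) v)"
  unfolding smooth_def using Ck.simps(2) by blast

text \<open>A polynomial factor preserves smoothness and can only shrink the support, so the
  defining identity of the weak gradient may be applied to polynomially weighted test
  functions.\<close>

lemma test_function_mult_polynomial:
  assumes "test_function \<Omega> \<phi>" and "real_polynomial_function p"
  shows "test_function \<Omega> (\<lambda>x. \<phi> x * p x)"
proof -
  have "closure {x. \<phi> x * p x \<noteq> 0} \<subseteq> closure {x. \<phi> x \<noteq> 0}"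
    by (auto intro!: closure_mono)
  moreover have "compact (closure {x. \<phi> x * p x \<noteq> 0})"
    using assms(1) bounded_subset[of "{x. \<phi> x \<noteq> 0}" "{x. \<phi> x * p x \<noteq> 0}"]
    unfolding test_function_def compact_closure by auto
  ultimately show ?thesis using assms
    unfolding test_function_def smooth_def
    by (blast intro: Ck_mult Ck_real_polynomial_function)
qed

lemma test_function_shift:
  fixes c :: "'a::euclidean_space"
  assumes "test_function \<Omega> \<phi>" and "\<And>x. x \<in> closure {x. \<phi> x \<noteq> 0} \<Longrightarrow> x - c \<in> \<Omega>"
  shows "test_function \<Omega> (\<lambda>x. \<phi> (x + c))"
proof -
  have "{x. \<phi> (x + c) \<noteq> 0} = (+) (-c) ` {x. \<phi> x \<noteq> 0}"
    by (force simp: image_iff intro: exI[of _ "_ + c"])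
  then have cl: "closure {x. \<phi> (x + c) \<noteq> 0} = (+) (-c) ` closure {x. \<phi> x \<noteq> 0}"
    by (metis closure_translation)
  have "compact (closure {x. \<phi> (x + c) \<noteq> 0})"
    unfolding cl using assms(1) compact_translation unfolding test_function_def by blast
  moreover have "closure {x. \<phi> (x + c) \<noteq> 0} \<subseteq> \<Omega>"
    unfolding cl using assms(2) by auto
  moreover have "smooth (\<lambda>x. \<phi> (x + c))"
    using assms(1) Ck_shift unfolding test_function_def smooth_def by blast
  ultimately show ?thesis unfolding test_function_def by blast
qed

subsection \<open>Difference quotients and the weak chain rule\<close>

text \<open>Thicken \<open>K\<close> by the closed unit ball to a compact \<open>K'\<close>. Two
  points at distance below 1 either both lie in \<open>K'\<close>, where Heine-Cantor applies, or
  both lie off \<open>K\<close>, where \<open>g\<close> vanishes.\<close>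

lemma uniformly_continuous_compact_support:
  fixes g :: "'a::euclidean_space \<Rightarrow> real"
  assumes "continuous_on UNIV g" "compact K" "\<And>x. x \<notin> K \<Longrightarrow> g x = 0"
  shows "uniformly_continuous_on UNIV g"
proof -
  define K' where "K' = {x + y | x y. x \<in> K \<and> y \<in> cball (0::'a) 1}"
  have "compact K'" unfolding K'_def using assms(2) by (intro compact_sums) auto
  then have u: "uniformly_continuous_on K' g"
    using assms(1) compact_uniformly_continuous continuous_on_subset by blast
  have K': "x \<in> K'" if "y \<in> K" "dist x y < 1" for x y
  proof -
    have "x = y + (x - y)" "x - y \<in> cball 0 1" using that by (auto simp: dist_norm norm_minus_commute)
    then show ?thesis unfolding K'_def using that by blast
  qed
  show ?thesis unfolding uniformly_continuous_on_def
  proof (intro allI impI)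
    fix e :: real assume "0 < e"
    then obtain d where d: "d > 0" "\<And>x x'. \<lbrakk>x \<in> K'; x' \<in> K'; dist x' x < d\<rbrakk> \<Longrightarrow> dist (g x') (g x) < e"
      using u unfolding uniformly_continuous_on_def by metis
    have "dist (g x') (g x) < e" if "dist x' x < min d 1" for x x'
    proof (cases "x \<in> K \<or> x' \<in> K")
      case True
      then have "x \<in> K'" "x' \<in> K'" using that K' by (metis dist_commute dist_self min_less_iff_conj zero_less_one)+
      then show ?thesis using d(2) that by simp
    next
      case False
      then show ?thesis using assms(3) \<open>0 < e\<close> by simp
    qed
    then show "\<exists>d>0. \<forall>x\<in>UNIV. \<forall>x'\<in>UNIV. dist x' x < d \<longrightarrow> dist (g x') (g x) < e"
      using d(1) by (intro exI[of _ "min d 1"]) auto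
  qed
qed

lemma bounded_compact_support:
  fixes g :: "'a::euclidean_space \<Rightarrow> real"
  assumes "continuous_on UNIV g" "compact K" "\<And>x. x \<notin> K \<Longrightarrow> g x = 0"
  shows "\<exists>B>0. \<forall>x. \<bar>g x\<bar> \<le> B"
proof -
  have "bounded (g ` K)"
    by (intro compact_imp_bounded compact_continuous_image assms(2) continuous_on_subset[OF assms(1)]) simp
  then obtain B where B: "B > 0" "\<And>x. x \<in> K \<Longrightarrow> \<bar>g x\<bar> \<le> B"
    unfolding bounded_pos by auto
  have "\<bar>g x\<bar> \<le> B" for x using B assms(3)[of x] by (cases "x \<in> K") auto
  then show ?thesis using B(1) by blast
qed

lemma square_integrable_imp_integrable:
  assumes "finite_measure M" "square_integrable M f"
  shows "integrable M f"
proof (rule Bochner_Integration.integrable_bound)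
  interpret finite_measure M by fact
  show "integrable M (\<lambda>x. 1 + (norm (f x))\<^sup>2)"
    using assms(2) unfolding square_integrable_def by auto
  show "f \<in> borel_measurable M" using assms(2) unfolding square_integrable_def by auto
  show "AE x in M. norm (f x) \<le> norm (1 + (norm (f x))\<^sup>2)"
  proof (rule AE_I2)
    fix x
    have "0 \<le> (norm (f x) - 1)\<^sup>2 + (norm (f x))\<^sup>2 + 1" by simp
    then have "norm (f x) \<le> 1 + (norm (f x))\<^sup>2" by (simp add: power2_eq_square algebra_simps)
    then show "norm (f x) \<le> norm (1 + (norm (f x))\<^sup>2)" by simp
  qed
qed

lemma finite_measure_lebesgue_on_bounded_open:
  fixes \<Omega> :: "'a::euclidean_space set"
  assumes "open \<Omega>" "bounded \<Omega>"
  shows "finite_measure (lebesgue_on \<Omega>)"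
  using assms by (simp add: finite_measure_lebesgue_on lmeasurable_open)

lemma integrable_mult_bounded_continuous:
  fixes w :: "'a::euclidean_space \<Rightarrow> real"
  assumes "open \<Omega>" and w: "integrable (lebesgue_on \<Omega>) w"
    and "continuous_on \<Omega> g" "\<And>x. x \<in> \<Omega> \<Longrightarrow> \<bar>g x\<bar> \<le> B"
  shows "integrable (lebesgue_on \<Omega>) (\<lambda>x. w x * g x)"
proof (rule Bochner_Integration.integrable_bound)
  show "integrable (lebesgue_on \<Omega>) (\<lambda>x. B * w x)" using w by simp
  have "g \<in> borel_measurable (lebesgue_on \<Omega>)"
    using assms by (intro continuous_imp_measurable_on_sets_lebesgue) auto
  then show "(\<lambda>x. w x * g x) \<in> borel_measurable (lebesgue_on \<Omega>)" using w by auto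
  have "\<bar>w x * g x\<bar> \<le> \<bar>B * w x\<bar>" if "x \<in> \<Omega>" for x
    using mult_right_mono[of "\<bar>g x\<bar>" "\<bar>B\<bar>" "\<bar>w x\<bar>"] assms(4)[OF that]
    by (auto simp: abs_mult mult.commute)
  then show "AE x in lebesgue_on \<Omega>. norm (w x * g x) \<le> norm (B * w x)"
    by (intro AE_I2) simp
qed

lemma test_function_zero: "x \<notin> closure {x. \<phi> x \<noteq> 0} \<Longrightarrow> \<phi> x = 0"
  using closure_subset[of "{x. \<phi> x \<noteq> 0}"] by auto

lemma frechet_derivative_zero_off_support:
  assumes "x \<notin> closure {x. \<phi> x \<noteq> 0}"
  shows "frechet_derivative \<phi> (at x) v = 0"
proof -
  have "(\<phi> has_derivative (\<lambda>_. 0)) (at x)"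
  proof (rule has_derivative_transform_within_open)
    show "((\<lambda>_. 0) has_derivative (\<lambda>_. 0)) (at x)" by (rule has_derivative_const)
    show "open (- closure {x. \<phi> x \<noteq> 0})" by (rule open_Compl[OF closed_closure])
    show "x \<in> - closure {x. \<phi> x \<noteq> 0}" using assms by simp
    show "0 = \<phi> y" if "y \<in> - closure {x. \<phi> x \<noteq> 0}" for y
      using test_function_zero[of y \<phi>] that by simp
  qed
  from frechet_derivative_at[OF this] show ?thesis by metis
qed

section \<open>Shifted test functions and weak difference quotients\<close>

lemma smooth_has_derivative_line:
  assumes "smooth \<phi>"
  shows "((\<lambda>t. \<phi> (x + t *\<^sub>R e)) has_field_derivative frechet_derivative \<phi> (at (x + t *\<^sub>R e)) e) (at t)"
proof -
  have "((\<lambda>t. x + t *\<^sub>R e) has_derivative (\<lambda>s. s *\<^sub>R e)) (at t)"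
    by (auto intro!: derivative_eq_intros)
  moreover have d: "(\<phi> has_derivative frechet_derivative \<phi> (at (x + t *\<^sub>R e))) (at (x + t *\<^sub>R e))"
    using assms smooth_differentiable frechet_derivative_works by blast
  ultimately have "((\<lambda>t. \<phi> (x + t *\<^sub>R e)) has_derivative
      (\<lambda>s. frechet_derivative \<phi> (at (x + t *\<^sub>R e)) (s *\<^sub>R e))) (at t)"
    by (rule has_derivative_compose)
  moreover have "frechet_derivative \<phi> (at (x + t *\<^sub>R e)) (s *\<^sub>R e) =
      frechet_derivative \<phi> (at (x + t *\<^sub>R e)) e * s" for s
    using d has_derivative_linear linear_scale by (metis mult.commute real_scaleR_def)
  ultimately show ?thesis unfolding has_field_derivative_def by simp
qed

text \<open>Differentiation under the integral sign. The directional derivative \<open>D\<close> is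
  continuous and vanishes off the support of \<phi>, hence is bounded by some \<open>L\<close>; the
  mean value inequality then dominates all difference quotients by
  \<open>L * \<bar>w x\<bar>\<close>. The shift acts on \<phi> alone, so integrability of
  \<open>w\<close> suffices.\<close>

lemma integral_shift_has_derivative:
  fixes w :: "'a::euclidean_space \<Rightarrow> real"
  assumes "open \<Omega>" "integrable (lebesgue_on \<Omega>) w" "test_function \<Omega> \<phi>"
  shows "((\<lambda>t. LINT x|lebesgue_on \<Omega>. w x * \<phi> (x + t *\<^sub>R e)) has_field_derivative
          (LINT x|lebesgue_on \<Omega>. w x * frechet_derivative \<phi> (at (x + t *\<^sub>R e)) e)) (at t)"
proof -
  define D where "D x = frechet_derivative \<phi> (at x) e" for x
  have sm: "smooth \<phi>" and K: "compact (closure {x. \<phi> x \<noteq> 0})"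
    using assms(3) unfolding test_function_def by auto
  have cD: "continuous_on UNIV D"
    unfolding D_def by (rule smooth_continuous[OF smooth_derivative[OF sm]])
  have "\<exists>L>0. \<forall>x. \<bar>D x\<bar> \<le> L"
    by (rule bounded_compact_support[OF cD K]) (unfold D_def, rule frechet_derivative_zero_off_support)
  then obtain L where L: "L > 0" "\<And>x. \<bar>D x\<bar> \<le> L" by auto
  have "\<exists>B>0. \<forall>x. \<bar>\<phi> x\<bar> \<le> B"
    by (rule bounded_compact_support[OF smooth_continuous[OF sm] K]) (rule test_function_zero)
  then obtain B where B: "B > 0" "\<And>x. \<bar>\<phi> x\<bar> \<le> B" by auto
  have lip: "\<bar>\<phi> (x + s *\<^sub>R e) - \<phi> (x + t *\<^sub>R e)\<bar> \<le> L * \<bar>s - t\<bar>" for x s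
  proof -
    have "norm (\<phi> (x + s *\<^sub>R e) - \<phi> (x + t *\<^sub>R e)) \<le> L * norm (s - t)"
      by (rule field_differentiable_bound[of UNIV "\<lambda>t. \<phi> (x + t *\<^sub>R e)" "\<lambda>t. D (x + t *\<^sub>R e)"])
         (simp_all add: L(2), simp add: D_def smooth_has_derivative_line[OF sm])
    then show ?thesis by simp
  qed
  have c\<phi>: "continuous_on \<Omega> (\<lambda>x. \<phi> (x + s *\<^sub>R e))" for s
    by (rule continuous_on_compose2[OF smooth_continuous[OF sm]]) (auto intro: continuous_intros)
  have int: "integrable (lebesgue_on \<Omega>) (\<lambda>x. w x * \<phi> (x + s *\<^sub>R e))" for s
    by (rule integrable_mult_bounded_continuous[OF assms(1,2) c\<phi> B(2)])
  have mD: "(\<lambda>x. w x * D (x + t *\<^sub>R e)) \<in> borel_measurable (lebesgue_on \<Omega>)"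
  proof -
    have "continuous_on \<Omega> (\<lambda>x. D (x + t *\<^sub>R e))"
      by (rule continuous_on_compose2[OF cD]) (auto intro: continuous_intros)
    then have "integrable (lebesgue_on \<Omega>) (\<lambda>x. w x * D (x + t *\<^sub>R e))"
      by (rule integrable_mult_bounded_continuous[OF assms(1,2) _ L(2)])
    then show ?thesis by auto
  qed
  \<comment> \<open>The limit is tested along arbitrary sequences \<open>X\<close>, the setting of
    the dominated convergence theorem.\<close>
  show ?thesis
    unfolding has_field_derivative_iff tendsto_at_iff_sequentially D_def[symmetric] o_def
  proof (intro allI impI)
    fix X :: "nat \<Rightarrow> real"
    assume X: "\<forall>i. X i \<in> UNIV - {t}" "X \<longlonglongrightarrow> t"
    have "(\<lambda>i. LINT x|lebesgue_on \<Omega>. w x * ((\<phi> (x + X i *\<^sub>R e) - \<phi> (x + t *\<^sub>R e)) / (X i - t)))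
        \<longlonglongrightarrow> (LINT x|lebesgue_on \<Omega>. w x * D (x + t *\<^sub>R e))"
    proof (rule integral_dominated_convergence[where w = "\<lambda>x. L * \<bar>w x\<bar>"])
      show "(\<lambda>x. w x * ((\<phi> (x + X i *\<^sub>R e) - \<phi> (x + t *\<^sub>R e)) / (X i - t)))
          \<in> borel_measurable (lebesgue_on \<Omega>)" for i
        using borel_measurable_integrable[OF Bochner_Integration.integrable_diff[OF int[of "X i"] int[of t]]]
        by (simp add: right_diff_distrib[symmetric])
      show "integrable (lebesgue_on \<Omega>) (\<lambda>x. L * \<bar>w x\<bar>)" using assms(2) by simp
      show "AE x in lebesgue_on \<Omega>. (\<lambda>i. w x * ((\<phi> (x + X i *\<^sub>R e) - \<phi> (x + t *\<^sub>R e)) / (X i - t)))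
          \<longlonglongrightarrow> w x * D (x + t *\<^sub>R e)"
      proof (intro AE_I2 tendsto_mult_left)
        fix x
        show "(\<lambda>i. (\<phi> (x + X i *\<^sub>R e) - \<phi> (x + t *\<^sub>R e)) / (X i - t)) \<longlonglongrightarrow> D (x + t *\<^sub>R e)"
          using smooth_has_derivative_line[OF sm, of x e t] X
          unfolding has_field_derivative_iff tendsto_at_iff_sequentially D_def o_def by blast
      qed
      have "\<bar>(\<phi> (x + X i *\<^sub>R e) - \<phi> (x + t *\<^sub>R e)) / (X i - t)\<bar> \<le> L" for x i
        using lip[of x "X i"] X(1) by (simp add: divide_le_eq)
      then have "\<bar>w x * ((\<phi> (x + X i *\<^sub>R e) - \<phi> (x + t *\<^sub>R e)) / (X i - t))\<bar> \<le> L * \<bar>w x\<bar>" for x i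
        unfolding abs_mult by (metis abs_ge_zero mult.commute mult_right_mono)
      then show "AE x in lebesgue_on \<Omega>.
          norm (w x * ((\<phi> (x + X i *\<^sub>R e) - \<phi> (x + t *\<^sub>R e)) / (X i - t))) \<le> L * \<bar>w x\<bar>" for i
        by simp
    qed (fact mD)
    moreover have eq: "(LINT x|lebesgue_on \<Omega>. w x * ((\<phi> (x + s *\<^sub>R e) - \<phi> (x + t *\<^sub>R e)) / (s - t)))
       = ((LINT x|lebesgue_on \<Omega>. w x * \<phi> (x + s *\<^sub>R e)) - (LINT x|lebesgue_on \<Omega>. w x * \<phi> (x + t *\<^sub>R e))) / (s - t)" for s
      unfolding Bochner_Integration.integral_diff[OF int int, symmetric] integral_divide_zero[symmetric]
      by (simp add: right_diff_distrib)
    ultimately show "(\<lambda>i. ((LINT x|lebesgue_on \<Omega>. w x * \<phi> (x + X i *\<^sub>R e)) -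
        (LINT x|lebesgue_on \<Omega>. w x * \<phi> (x + t *\<^sub>R e))) / (X i - t))
        \<longlonglongrightarrow> (LINT x|lebesgue_on \<Omega>. w x * D (x + t *\<^sub>R e))"
      by (simp only: eq)
  qed
qed

lemma frechet_derivative_shift:
  fixes \<phi> :: "'a::real_normed_vector \<Rightarrow> real"
  assumes "smooth \<phi>"
  shows "frechet_derivative (\<lambda>x. \<phi> (x + c)) (at x) = frechet_derivative \<phi> (at (x + c))"
  using frechet_derivative_at[OF has_derivative_shift[OF smooth_differentiable[OF assms]]] by simp

text \<open>The closed support of \<phi> and the closed zero set of \<phi> cover the space; on the
  second the product is 0 whatever \<open>c\<close> is there. This allows weights such as
  \<open>w (x - h *\<^sub>R e)\<close>, which are controlled only near the support.\<close>

lemma continuous_on_mult_support: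
  fixes \<phi> c :: "'a::euclidean_space \<Rightarrow> real"
  assumes "continuous_on UNIV \<phi>" and "continuous_on (closure {x. \<phi> x \<noteq> 0}) c"
  shows "continuous_on UNIV (\<lambda>x. \<phi> x * c x)"
proof -
  have "closed {x. \<phi> x = 0}"
    using continuous_closed_vimage[of "{0}" \<phi>] assms(1)
    by (simp add: continuous_on_eq_continuous_at vimage_def)
  moreover have "continuous_on (closure {x. \<phi> x \<noteq> 0}) (\<lambda>x. \<phi> x * c x)"
    by (intro continuous_on_mult assms(2) continuous_on_subset[OF assms(1)]) simp
  moreover have "continuous_on {x. \<phi> x = 0} (\<lambda>x. \<phi> x * c x)"
    by (rule continuous_on_eq[of _ "\<lambda>_. 0"]) auto
  ultimately have "continuous_on (closure {x. \<phi> x \<noteq> 0} \<union> {x. \<phi> x = 0}) (\<lambda>x. \<phi> x * c x)"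
    by (intro continuous_on_closed_Un closed_closure)
  moreover have "closure {x. \<phi> x \<noteq> 0} \<union> {x. \<phi> x = 0} = UNIV"
    using closure_subset[of "{x. \<phi> x \<noteq> 0}"] by auto
  ultimately show ?thesis by simp
qed

lemma abs_integral_mult_le:
  fixes w :: "'a::euclidean_space \<Rightarrow> real"
  assumes "open \<Omega>" "integrable (lebesgue_on \<Omega>) w"
    and "continuous_on \<Omega> g" "\<And>x. x \<in> \<Omega> \<Longrightarrow> \<bar>g x\<bar> \<le> B"
  shows "\<bar>LINT x|lebesgue_on \<Omega>. w x * g x\<bar> \<le> B * (LINT x|lebesgue_on \<Omega>. \<bar>w x\<bar>)"
proof -
  have i: "integrable (lebesgue_on \<Omega>) (\<lambda>x. w x * g x)"
    by (rule integrable_mult_bounded_continuous[OF assms])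
  have "\<bar>LINT x|lebesgue_on \<Omega>. w x * g x\<bar> \<le> (LINT x|lebesgue_on \<Omega>. \<bar>w x * g x\<bar>)"
    by (rule integral_abs_bound)
  also have "\<dots> \<le> (LINT x|lebesgue_on \<Omega>. B * \<bar>w x\<bar>)"
  proof (rule integral_mono)
    fix x assume "x \<in> space (lebesgue_on \<Omega>)"
    then have "\<bar>g x\<bar> \<le> B" using assms(4) by simp
    then show "\<bar>w x * g x\<bar> \<le> B * \<bar>w x\<bar>"
      using mult_left_mono[of "\<bar>g x\<bar>" B "\<bar>w x\<bar>"] by (simp add: abs_mult mult.commute)
  qed (use i assms(2) in auto)
  finally show ?thesis by simp
qed

lemma integral_lebesgue_on_shift:
  fixes f g :: "'a::euclidean_space \<Rightarrow> real"
  assumes "open \<Omega>" and g: "\<And>x. x \<notin> K \<Longrightarrow> g x = 0" and K: "\<And>x. x \<in> K \<Longrightarrow> x \<in> \<Omega> \<and> x - c \<in> \<Omega>"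
    and cont: "continuous_on UNIV (\<lambda>x. f (x - c) * g x)"
  shows "(LINT x|lebesgue_on \<Omega>. f x * g (x + c)) = (LINT x|lebesgue_on \<Omega>. f (x - c) * g x)"
proof -
  define F where "F x = f (x - c) * g x" for x
  have [measurable]: "F \<in> borel_measurable borel"
    using cont unfolding F_def by (rule borel_measurable_continuous_onI)
  have \<Omega>: "\<Omega> \<in> sets lebesgue" using assms(1) by simp
  \<comment> \<open>For the second equation: if \<open>x + c\<close> were in \<open>K\<close>, then
    \<open>x\<close>, being \<open>(x + c) - c\<close>, would lie in \<Omega>.\<close>
  have z: "g x = 0" "g (x + c) = 0" if "x \<notin> \<Omega>" for x
    using K[of "x + c"] K[of x] g[of x] g[of "x + c"] that by auto
  have "(LINT x|lebesgue_on \<Omega>. f x * g (x + c)) = (LINT x|lebesgue. F (c + x))"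
    using \<Omega> z by (subst integral_restrict_space)
      (auto intro!: Bochner_Integration.integral_cong simp: F_def indicator_def add.commute)
  also have "\<dots> = (LINT x|lborel. F (c + x))"
    by (rule integral_completion) simp
  also have "\<dots> = (LINT x|distr lborel borel ((+) c). F x)"
    by (rule integral_distr[symmetric]) auto
  also have "\<dots> = (LINT x|lebesgue. F x)"
    unfolding lborel_distr_plus by (rule integral_completion[symmetric]) simp
  also have "\<dots> = (LINT x|lebesgue_on \<Omega>. f (x - c) * g x)"
    using \<Omega> z by (subst integral_restrict_space)
      (auto intro!: Bochner_Integration.integral_cong simp: F_def indicator_def)
  finally show ?thesis .
qed

text \<open>The classical mean value theorem applied to the integral as a function of the shift. Its
  derivative at the intermediate point is the weak derivative tested with the shifted \<phi>, still
  a test function because assumption \<open>K\<close> keeps the moved support inside \<Omega>. A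
  single intermediate shift replaces an average over shifts and hence any use of Fubini.\<close>

lemma weak_derivative_mean_value:
  assumes "open \<Omega>" "integrable (lebesgue_on \<Omega>) w" "H1_gradient \<Omega> w G" "test_function \<Omega> \<phi>"
    and e: "e \<in> Basis" and "h > 0"
    and K: "\<And>x t. x \<in> closure {x. \<phi> x \<noteq> 0} \<Longrightarrow> 0 \<le> t \<Longrightarrow> t \<le> h \<Longrightarrow> x - t *\<^sub>R e \<in> \<Omega>"
  shows "\<exists>t. 0 < t \<and> t < h \<and>
    (LINT x|lebesgue_on \<Omega>. w x * \<phi> (x + h *\<^sub>R e)) - (LINT x|lebesgue_on \<Omega>. w x * \<phi> x)
      = - h * (LINT x|lebesgue_on \<Omega>. (G x \<bullet> e) * \<phi> (x + t *\<^sub>R e))"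
proof -
  define A where "A t = (LINT x|lebesgue_on \<Omega>. w x * \<phi> (x + t *\<^sub>R e))" for t
  define A' where "A' t = (LINT x|lebesgue_on \<Omega>. w x * frechet_derivative \<phi> (at (x + t *\<^sub>R e)) e)" for t
  have "(A has_real_derivative A' t) (at t)" for t
    unfolding A_def A'_def by (rule integral_shift_has_derivative[OF assms(1,2,4)])
  then obtain z where z: "0 < z" "z < h" "A h - A 0 = (h - 0) * A' z"
    using MVT2[of 0 h A A'] \<open>h > 0\<close> by blast
  have sm: "smooth \<phi>" using assms(4) unfolding test_function_def by blast
  have "test_function \<Omega> (\<lambda>x. \<phi> (x + z *\<^sub>R e))"
    by (rule test_function_shift[OF assms(4)]) (use K z in auto)
  then have "(LINT x|lebesgue_on \<Omega>. w x * frechet_derivative (\<lambda>x. \<phi> (x + z *\<^sub>R e)) (at x) e) =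
        - (LINT x|lebesgue_on \<Omega>. (G x \<bullet> e) * \<phi> (x + z *\<^sub>R e))"
    using assms(3) e unfolding H1_gradient_def by blast
  then have "A' z = - (LINT x|lebesgue_on \<Omega>. (G x \<bullet> e) * \<phi> (x + z *\<^sub>R e))"
    unfolding A'_def frechet_derivative_shift[OF sm] .
  then have "A h - A 0 = - h * (LINT x|lebesgue_on \<Omega>. (G x \<bullet> e) * \<phi> (x + z *\<^sub>R e))"
    using z(3) by simp
  then show ?thesis using z(1,2) unfolding A_def by auto
qed

text \<open>Stone-Weierstrass replaces \<open>c\<close> by a polynomial \<open>p\<close>, for which \<open>\<phi> * p\<close> is again a test
  function; no mollifier is needed.\<close>

lemma weak_difference_quotient_bound:
  assumes "open \<Omega>" and w: "integrable (lebesgue_on \<Omega>) w" and G: "integrable (lebesgue_on \<Omega>) (\<lambda>x. G x \<bullet> e)"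
    and "H1_gradient \<Omega> w G" and tf: "test_function \<Omega> \<phi>"
    and e: "e \<in> Basis" and "h > 0"
    and K: "\<And>x t. x \<in> closure {x. \<phi> x \<noteq> 0} \<Longrightarrow> 0 \<le> t \<Longrightarrow> t \<le> h \<Longrightarrow> x - t *\<^sub>R e \<in> \<Omega>"
    and c: "continuous_on (closure {x. \<phi> x \<noteq> 0}) c"
    and g: "g = (\<lambda>x. \<phi> x * c x)"
    and osc: "\<And>x t. 0 \<le> t \<Longrightarrow> t \<le> h \<Longrightarrow> \<bar>g (x + t *\<^sub>R e) - g x\<bar> \<le> \<eta>"
  shows "\<bar>(LINT x|lebesgue_on \<Omega>. w x * (g (x + h *\<^sub>R e) - g x)) + h * (LINT x|lebesgue_on \<Omega>. (G x \<bullet> e) * g x)\<bar>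
     \<le> h * \<eta> * (LINT x|lebesgue_on \<Omega>. \<bar>G x \<bullet> e\<bar>)"
proof -
  define W N where "W = (LINT x|lebesgue_on \<Omega>. \<bar>w x\<bar>)" and "N = (LINT x|lebesgue_on \<Omega>. \<bar>G x \<bullet> e\<bar>)"
  have sm: "smooth \<phi>" and cK: "compact (closure {x. \<phi> x \<noteq> 0})"
    using tf unfolding test_function_def by auto
  note c\<phi> = smooth_continuous[OF sm]
  have "\<exists>B>0. \<forall>x. \<bar>\<phi> x\<bar> \<le> B"
    by (rule bounded_compact_support[OF c\<phi> cK]) (rule test_function_zero)
  then obtain B where B: "B > 0" "\<And>x. \<bar>\<phi> x\<bar> \<le> B" by auto
  have cg: "continuous_on UNIV g" unfolding g by (rule continuous_on_mult_support[OF c\<phi> c])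
  have shift: "continuous_on \<Omega> (\<lambda>x. f (x + a))" if "continuous_on UNIV f" for f :: "'a \<Rightarrow> real" and a
    by (rule continuous_on_compose2[OF that]) (auto intro: continuous_intros)
  let ?X = "\<bar>(LINT x|lebesgue_on \<Omega>. w x * (g (x + h *\<^sub>R e) - g x)) + h * (LINT x|lebesgue_on \<Omega>. (G x \<bullet> e) * g x)\<bar>"
  have main: "?X \<le> h * \<eta> * N + \<epsilon> * (2 * B * W + h * B * N)" if "\<epsilon> > 0" for \<epsilon>
  proof -
    obtain p where p: "real_polynomial_function p"
        "\<And>x. x \<in> closure {x. \<phi> x \<noteq> 0} \<Longrightarrow> \<bar>c x - p x\<bar> < \<epsilon>"
      using Stone_Weierstrass_real_polynomial_function[OF cK c \<open>\<epsilon> > 0\<close>] by blast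
    \<comment> \<open>\<open>q\<close> is a genuine test function that differs from \<open>g\<close>
      uniformly by at most \<open>B * \<epsilon>\<close>; the exact mean value identity holds for
      \<open>q\<close>.\<close>
    define q where "q x = \<phi> x * p x" for x
    have tq: "test_function \<Omega> q" unfolding q_def by (rule test_function_mult_polynomial[OF tf p(1)])
    then have cq: "continuous_on UNIV q" using smooth_continuous unfolding test_function_def by auto
    have "closure {x. q x \<noteq> 0} \<subseteq> closure {x. \<phi> x \<noteq> 0}"
      by (rule closure_mono) (auto simp: q_def)
    then have "\<exists>t. 0 < t \<and> t < h \<and>
      (LINT x|lebesgue_on \<Omega>. w x * q (x + h *\<^sub>R e)) - (LINT x|lebesgue_on \<Omega>. w x * q x)
      = - h * (LINT x|lebesgue_on \<Omega>. (G x \<bullet> e) * q (x + t *\<^sub>R e))"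
      by (intro weak_derivative_mean_value[OF assms(1) w assms(4) tq e \<open>h > 0\<close>] K) auto
    then obtain t where t: "0 < t" "t < h"
      "(LINT x|lebesgue_on \<Omega>. w x * q (x + h *\<^sub>R e)) - (LINT x|lebesgue_on \<Omega>. w x * q x)
      = - h * (LINT x|lebesgue_on \<Omega>. (G x \<bullet> e) * q (x + t *\<^sub>R e))" by blast
    have gq: "\<bar>g x - q x\<bar> \<le> B * \<epsilon>" for x
    proof (cases "x \<in> closure {x. \<phi> x \<noteq> 0}")
      case True
      have "\<bar>g x - q x\<bar> = \<bar>\<phi> x\<bar> * \<bar>c x - p x\<bar>"
        unfolding g q_def by (simp add: abs_mult flip: right_diff_distrib)
      also have "\<dots> \<le> B * \<epsilon>" using B p(2)[OF True] by (intro mult_mono) auto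
      finally show ?thesis .
    next
      case False
      then show ?thesis using test_function_zero[of x \<phi>] B(1) \<open>\<epsilon> > 0\<close> by (simp add: g q_def)
    qed
    have "\<exists>M>0. \<forall>x. \<bar>q x\<bar> \<le> M"
      using tq unfolding test_function_def
      by (intro bounded_compact_support[OF cq, of "closure {x. q x \<noteq> 0}"]) (blast, rule test_function_zero)
    then obtain M where M: "\<And>x. \<bar>q x\<bar> \<le> M" by auto
    have iq: "integrable (lebesgue_on \<Omega>) (\<lambda>x. w x * q (x + a))" for a
      by (rule integrable_mult_bounded_continuous[OF assms(1) w shift[OF cq] M])
    define r where "r x = (g (x + h *\<^sub>R e) - q (x + h *\<^sub>R e)) - (g x - q x)" for x
    have cr: "continuous_on \<Omega> r" unfolding r_def
      using shift[OF cg, of "h *\<^sub>R e"] shift[OF cq, of "h *\<^sub>R e"] shift[OF cg, of 0] shift[OF cq, of 0]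
      by (intro continuous_on_diff) simp_all
    have rB: "\<bar>r x\<bar> \<le> 2 * B * \<epsilon>" for x
      using gq[of x] gq[of "x + h *\<^sub>R e"] unfolding r_def by linarith
    have ir: "integrable (lebesgue_on \<Omega>) (\<lambda>x. w x * r x)"
      by (rule integrable_mult_bounded_continuous[OF assms(1) w cr rB])
    define s where "s x = g x - q (x + t *\<^sub>R e)" for x
    have cs: "continuous_on \<Omega> s" unfolding s_def
      using shift[OF cq, of "t *\<^sub>R e"] shift[OF cg, of 0] by (intro continuous_on_diff) simp_all
    \<comment> \<open>The \<eta> pays for undoing the unknown shift \<open>t\<close> (this is where
      \<open>osc\<close> enters), the \<open>B * \<epsilon>\<close> for replacing \<open>g\<close>
      by \<open>q\<close>.\<close>
    have sB: "\<bar>s x\<bar> \<le> \<eta> + B * \<epsilon>" for x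
      using gq[of "x + t *\<^sub>R e"] osc[of t x] t unfolding s_def by linarith
    have ist: "integrable (lebesgue_on \<Omega>) (\<lambda>x. (G x \<bullet> e) * s x)"
      by (rule integrable_mult_bounded_continuous[OF assms(1) G cs sB])
    have iGq: "integrable (lebesgue_on \<Omega>) (\<lambda>x. (G x \<bullet> e) * q (x + t *\<^sub>R e))"
      by (rule integrable_mult_bounded_continuous[OF assms(1) G shift[OF cq] M])
    have "(LINT x|lebesgue_on \<Omega>. w x * (g (x + h *\<^sub>R e) - g x))
       = (LINT x|lebesgue_on \<Omega>. w x * r x + (w x * q (x + h *\<^sub>R e) - w x * q x))"
      by (rule Bochner_Integration.integral_cong) (simp_all add: r_def algebra_simps)
    also have "\<dots> = (LINT x|lebesgue_on \<Omega>. w x * r x)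
       - h * (LINT x|lebesgue_on \<Omega>. (G x \<bullet> e) * q (x + t *\<^sub>R e))"
      using ir iq[of "h *\<^sub>R e"] iq[of 0] t(3) by simp
    finally have 1: "(LINT x|lebesgue_on \<Omega>. w x * (g (x + h *\<^sub>R e) - g x)) = (LINT x|lebesgue_on \<Omega>. w x * r x)
       - h * (LINT x|lebesgue_on \<Omega>. (G x \<bullet> e) * q (x + t *\<^sub>R e))" .
    have "(LINT x|lebesgue_on \<Omega>. (G x \<bullet> e) * g x)
       = (LINT x|lebesgue_on \<Omega>. (G x \<bullet> e) * s x + (G x \<bullet> e) * q (x + t *\<^sub>R e))"
      by (rule Bochner_Integration.integral_cong) (simp_all add: s_def algebra_simps)
    also have "\<dots> = (LINT x|lebesgue_on \<Omega>. (G x \<bullet> e) * s x) + (LINT x|lebesgue_on \<Omega>. (G x \<bullet> e) * q (x + t *\<^sub>R e))"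
      using ist iGq by simp
    finally have 2: "(LINT x|lebesgue_on \<Omega>. (G x \<bullet> e) * g x) = \<dots>" .
    have "?X = \<bar>(LINT x|lebesgue_on \<Omega>. w x * r x) + h * (LINT x|lebesgue_on \<Omega>. (G x \<bullet> e) * s x)\<bar>"
      unfolding 1 2 by (simp add: algebra_simps)
    also have "\<dots> \<le> \<bar>LINT x|lebesgue_on \<Omega>. w x * r x\<bar> + h * \<bar>LINT x|lebesgue_on \<Omega>. (G x \<bullet> e) * s x\<bar>"
      using abs_triangle_ineq[of "LINT x|lebesgue_on \<Omega>. w x * r x" "h * (LINT x|lebesgue_on \<Omega>. (G x \<bullet> e) * s x)"]
        \<open>h > 0\<close> by (simp add: abs_mult)
    also have "\<dots> \<le> 2 * B * \<epsilon> * W + h * ((\<eta> + B * \<epsilon>) * N)"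
      unfolding W_def N_def using \<open>h > 0\<close>
      by (intro add_mono mult_left_mono abs_integral_mult_le[OF assms(1) w cr rB]
          abs_integral_mult_le[OF assms(1) G cs sB]) auto
    also have "\<dots> = h * \<eta> * N + \<epsilon> * (2 * B * W + h * B * N)" by (simp add: algebra_simps)
    finally show ?thesis .
  qed
  \<comment> \<open>The polynomial error can be made arbitrarily small with \<open>h\<close> fixed:
    \<open>C\<close> collects its coefficients, and dividing by \<open>C + 1\<close> below also
    covers \<open>C = 0\<close>.\<close>
  define C where "C = 2 * B * W + h * B * N"
  have "C \<ge> 0" unfolding C_def W_def N_def using B(1) \<open>h > 0\<close> by simp
  have "?X \<le> h * \<eta> * N + \<delta>" if "\<delta> > 0" for \<delta>
  proof -
    have "\<delta> / (C + 1) * C \<le> \<delta>" using \<open>C \<ge> 0\<close> that by (simp add: field_simps)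
    then show ?thesis using main[of "\<delta> / (C + 1)"] \<open>C \<ge> 0\<close> that unfolding C_def[symmetric] by simp
  qed
  then show ?thesis unfolding N_def by (rule field_le_epsilon)
qed

text \<open>Hadamard's lemma: average \<Phi>' along the segment from \<open>a\<close> to
  \<open>b\<close>. Unlike the quotient of differences, this average is defined on the diagonal and
  jointly continuous there, so the slopes converge to \<Phi>' uniformly on compact squares.\<close>

lemma continuous_slope_exists:
  fixes \<Phi> \<Phi>' :: "real \<Rightarrow> real"
  assumes d: "\<And>t. (\<Phi> has_real_derivative \<Phi>' t) (at t)" and c: "continuous_on UNIV \<Phi>'"
  obtains m where "continuous_on UNIV (\<lambda>(a, b). m a b)" "\<And>a. m a a = \<Phi>' a"
    "\<And>a b. \<Phi> b - \<Phi> a = m a b * (b - a)"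
proof
  define m where "m a b = integral {0..1} (\<lambda>s. \<Phi>' (a + s * (b - a)))" for a b
  have "continuous_on UNIV (\<lambda>x. integral (cbox 0 1) (\<lambda>s. \<Phi>' (fst x + s * (snd x - fst x))))"
    by (rule integral_continuous_on_param)
       (auto simp: split_def intro!: continuous_on_compose2[OF c] continuous_intros)
  then show "continuous_on UNIV (\<lambda>(a, b). m a b)"
    unfolding m_def by (simp add: split_def)
  show "m a a = \<Phi>' a" for a unfolding m_def by simp
  show "\<Phi> b - \<Phi> a = m a b * (b - a)" for a b
  proof -
    have "((\<lambda>s. \<Phi> (a + s * (b - a))) has_vector_derivative \<Phi>' (a + s * (b - a)) * (b - a)) (at s within {0..1})" for s
    proof -
      have "((\<lambda>s. \<Phi> (a + s * (b - a))) has_real_derivative \<Phi>' (a + s * (b - a)) * (b - a)) (at s)"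
        by (rule DERIV_chain2[OF d]) (auto intro!: derivative_eq_intros)
      then show ?thesis
        by (simp add: has_real_derivative_iff_has_vector_derivative has_vector_derivative_at_within)
    qed
    then have "((\<lambda>s. \<Phi>' (a + s * (b - a)) * (b - a)) has_integral \<Phi> (a + 1 * (b - a)) - \<Phi> (a + 0 * (b - a))) {0..1}"
      by (intro fundamental_theorem_of_calculus) auto
    from integral_unique[OF this] show ?thesis unfolding m_def by simp
  qed
qed

lemma H1_gradient_imp_integrable:
  fixes \<Omega> :: "'a::euclidean_space set"
  assumes "open \<Omega>" "bounded \<Omega>" "H1_gradient \<Omega> w G"
  shows "integrable (lebesgue_on \<Omega>) w" "integrable (lebesgue_on \<Omega>) (\<lambda>x. G x \<bullet> e)"
proof -
  have f: "finite_measure (lebesgue_on \<Omega>)"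
    by (rule finite_measure_lebesgue_on_bounded_open[OF assms(1,2)])
  have sq: "square_integrable (lebesgue_on \<Omega>) w" "square_integrable (lebesgue_on \<Omega>) G"
    using assms(3) unfolding H1_gradient_def by blast+
  show "integrable (lebesgue_on \<Omega>) w" by (rule square_integrable_imp_integrable[OF f sq(1)])
  show "integrable (lebesgue_on \<Omega>) (\<lambda>x. G x \<bullet> e)"
    by (intro integrable_inner_left square_integrable_imp_integrable[OF f sq(2)])
qed

text \<open>With \<open>m\<close> the continuous slope function of \<open>\<Phi>\<close>, a translation turns the difference quotient of
  \<open>\<phi>\<close> against \<open>\<Phi> (w x)\<close> into the difference quotient of \<open>w\<close> against
  \<open>\<phi> x * m (w (x - h *\<^sub>R e)) (w x)\<close>, which converges uniformly to \<open>\<phi> x * \<Phi>' (w x)\<close>.\<close>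

lemma weak_derivative_chain_rule:
  fixes \<Omega> :: "'a::euclidean_space set"
  assumes "open \<Omega>" "bounded \<Omega>" and cw: "continuous_on (closure \<Omega>) w" and H: "H1_gradient \<Omega> w G"
    and d: "\<And>t. (\<Phi> has_real_derivative \<Phi>' t) (at t)" and c': "continuous_on UNIV \<Phi>'"
    and tf: "test_function \<Omega> \<phi>" and e: "e \<in> Basis"
  shows "(LINT x|lebesgue_on \<Omega>. \<Phi> (w x) * frechet_derivative \<phi> (at x) e) =
     - (LINT x|lebesgue_on \<Omega>. (G x \<bullet> e) * (\<phi> x * \<Phi>' (w x)))"
proof -
  let ?K = "closure {x. \<phi> x \<noteq> 0}"
  let ?L = "lebesgue_on \<Omega>"
  note iw = H1_gradient_imp_integrable(1)[OF assms(1,2) H]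
  note iG = H1_gradient_imp_integrable(2)[OF assms(1,2) H, of e]
  have sm: "smooth \<phi>" and cK: "compact ?K" and K\<Omega>: "?K \<subseteq> \<Omega>"
    using tf unfolding test_function_def by auto
  note c\<phi> = smooth_continuous[OF sm]
  have "\<exists>B>0. \<forall>x. \<bar>\<phi> x\<bar> \<le> B"
    by (rule bounded_compact_support[OF c\<phi> cK]) (rule test_function_zero)
  then obtain B where B: "B > 0" "\<And>x. \<bar>\<phi> x\<bar> \<le> B" by auto
  \<comment> \<open>\<delta> is the room around the support of \<phi>: all shifts up to \<delta>
    stay in \<Omega>.\<close>
  obtain \<delta> where \<delta>: "\<delta> > 0" "(\<Union>x\<in>?K. cball x \<delta>) \<subseteq> \<Omega>"
    using compact_subset_open_imp_cball_epsilon_subset[OF cK assms(1) K\<Omega>] by blast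
  have K: "x - t *\<^sub>R e \<in> \<Omega>" if "x \<in> ?K" "0 \<le> t" "t \<le> \<delta>" for x t
  proof -
    have "x - t *\<^sub>R e \<in> cball x \<delta>" using that e by (simp add: dist_norm)
    then show ?thesis using \<delta>(2) that(1) by blast
  qed
  have ccl: "compact (closure \<Omega>)" using assms(2) by simp
  have ucw: "uniformly_continuous_on (closure \<Omega>) w"
    by (rule compact_uniformly_continuous[OF cw ccl])
  have "bounded (w ` closure \<Omega>)" by (rule compact_imp_bounded[OF compact_continuous_image[OF cw ccl]])
  then obtain M where M: "\<And>x. x \<in> closure \<Omega> \<Longrightarrow> \<bar>w x\<bar> \<le> M" unfolding bounded_iff by auto
  have cw\<Omega>: "continuous_on \<Omega> w" by (rule continuous_on_subset[OF cw closure_subset])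
  have c\<Phi>: "continuous_on UNIV \<Phi>" by (rule DERIV_continuous_on) (rule has_field_derivative_at_within[OF d])
  obtain m where m: "continuous_on UNIV (\<lambda>(a, b). m a b)" "\<And>a. m a a = \<Phi>' a"
      "\<And>a b. \<Phi> b - \<Phi> a = m a b * (b - a)"
    using continuous_slope_exists[OF d c'] by blast
  have "uniformly_continuous_on ({-M..M} \<times> {-M..M}) (\<lambda>(a, b). m a b)"
    by (intro compact_uniformly_continuous continuous_on_subset[OF m(1)] compact_Times) auto
  \<comment> \<open>Compare the slope at \<open>(a, b)\<close> with that at the diagonal point
    \<open>(b, b)\<close>; their distance is \<open>\<bar>a - b\<bar>\<close>, and the diagonal
    value is \<Phi>'.\<close>
  then have mu: "\<exists>d>0. \<forall>a\<in>{-M..M}. \<forall>b\<in>{-M..M}. \<bar>a - b\<bar> < d \<longrightarrow> \<bar>m a b - \<Phi>' b\<bar> < \<epsilon>" if "\<epsilon> > 0" for \<epsilon>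
  proof -
    obtain d where d: "d > 0" "\<And>x y. x \<in> {-M..M} \<times> {-M..M} \<Longrightarrow> y \<in> {-M..M} \<times> {-M..M} \<Longrightarrow> dist y x < d
        \<Longrightarrow> dist (case y of (a, b) \<Rightarrow> m a b) (case x of (a, b) \<Rightarrow> m a b) < \<epsilon>"
      using \<open>uniformly_continuous_on ({-M..M} \<times> {-M..M}) (\<lambda>(a, b). m a b)\<close> \<open>\<epsilon> > 0\<close>
      unfolding uniformly_continuous_on_def by meson
    have "\<bar>m a b - \<Phi>' b\<bar> < \<epsilon>" if "a \<in> {-M..M}" "b \<in> {-M..M}" "\<bar>a - b\<bar> < d" for a b
      using d(2)[of "(b, b)" "(a, b)"] that by (simp add: dist_Pair_Pair dist_real_def m(2))
    then show ?thesis using d(1) by blast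
  qed
  define g0 where "g0 x = \<phi> x * \<Phi>' (w x)" for x
  define gh where "gh h x = \<phi> x * m (w (x - h *\<^sub>R e)) (w x)" for h x
  have wK: "continuous_on ?K (\<lambda>x. w (x - h *\<^sub>R e))" if "0 \<le> h" "h \<le> \<delta>" for h
    by (rule continuous_on_compose2[OF cw\<Omega>]) (use K that in \<open>auto intro!: continuous_intros\<close>)
  have wK0: "continuous_on ?K w" by (rule continuous_on_subset[OF cw\<Omega> K\<Omega>])
  have cg0: "continuous_on UNIV g0"
    unfolding g0_def by (intro continuous_on_mult_support[OF c\<phi>] continuous_on_compose2[OF c' wK0]) simp
  have cmh: "continuous_on ?K (\<lambda>x. m (w (x - h *\<^sub>R e)) (w x))" if "0 \<le> h" "h \<le> \<delta>" for h
    using continuous_on_compose2[OF m(1) continuous_on_Pair[OF wK[OF that] wK0]] by simp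
  have cgh: "continuous_on UNIV (gh h)" if "0 \<le> h" "h \<le> \<delta>" for h
    unfolding gh_def by (rule continuous_on_mult_support[OF c\<phi> cmh[OF that]])
  have g0z: "g0 x = 0" and ghz: "gh h x = 0" if "x \<notin> ?K" for x h
    unfolding g0_def gh_def by (simp_all only: test_function_zero[OF that] mult_zero_left)
  have ug0: "uniformly_continuous_on UNIV g0"
    by (rule uniformly_continuous_compact_support[OF cg0 cK g0z])
  define A where "A t = (LINT x|?L. \<Phi> (w x) * \<phi> (x + t *\<^sub>R e))" for t
  define D where "D = (LINT x|?L. \<Phi> (w x) * frechet_derivative \<phi> (at x) e)"
  define I where "I = (LINT x|?L. (G x \<bullet> e) * g0 x)"
  define N where "N = (LINT x|?L. \<bar>G x \<bullet> e\<bar>)"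
  have N0: "N \<ge> 0" unfolding N_def by simp
  have i1: "integrable ?L (\<lambda>_. 1 :: real)"
    using finite_measure_lebesgue_on_bounded_open[OF assms(1,2)] by (simp add: finite_measure.integrable_const)
  have ibd: "integrable ?L f" if "continuous_on \<Omega> f" "\<And>x. x \<in> \<Omega> \<Longrightarrow> \<bar>f x\<bar> \<le> C" for f :: "'a \<Rightarrow> real" and C
    using integrable_mult_bounded_continuous[OF assms(1) i1 that] by simp
  have "bounded ((\<lambda>x. \<Phi> (w x)) ` closure \<Omega>)"
    by (intro compact_imp_bounded compact_continuous_image[OF _ ccl] continuous_on_compose2[OF c\<Phi> cw]) simp
  then obtain M2 where M2: "\<And>x. x \<in> closure \<Omega> \<Longrightarrow> \<bar>\<Phi> (w x)\<bar> \<le> M2" unfolding bounded_iff by auto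
  have i\<Phi>: "integrable ?L (\<lambda>x. \<Phi> (w x))"
    by (rule ibd[of _ M2]) (use M2 closure_subset[of \<Omega>] in \<open>auto intro!: continuous_on_compose2[OF c\<Phi> cw\<Omega>]\<close>)
  have "(A has_real_derivative D) (at 0)"
    using integral_shift_has_derivative[OF assms(1) i\<Phi> tf, of e 0] unfolding A_def D_def by simp
  then have lim: "((\<lambda>h. (A h - A 0) / h) \<longlongrightarrow> D) (at 0)"
    by (simp add: DERIV_def)
  \<comment> \<open>Used at the shifts \<open>h\<close> and 0, and twice over: first to move the
    shift from \<phi> onto \<Phi> of \<open>w\<close>, then to move it from \<open>w\<close> back
    onto the new weight \<open>gh h\<close>.\<close>
  have ishift: "integrable ?L (\<lambda>x. f (x - t *\<^sub>R e) * g x)"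
    "(LINT x|?L. f x * g (x + t *\<^sub>R e)) = (LINT x|?L. f (x - t *\<^sub>R e) * g x)"
    if t: "0 \<le> t" "t \<le> \<delta>" and g: "continuous_on UNIV g" "\<And>x. x \<notin> ?K \<Longrightarrow> g x = 0"
       and f: "continuous_on \<Omega> f" for f g :: "'a \<Rightarrow> real" and t
  proof -
    have "{x. g x \<noteq> 0} \<subseteq> ?K" using g(2) by blast
    then have sK: "closure {x. g x \<noteq> 0} \<subseteq> ?K" by (simp add: closure_minimal)
    have "continuous_on (closure {x. g x \<noteq> 0}) (\<lambda>x. f (x - t *\<^sub>R e))"
      by (rule continuous_on_compose2[OF f]) (use K t sK in \<open>auto intro!: continuous_intros\<close>)
    from continuous_on_mult_support[OF g(1) this]
    have cc: "continuous_on UNIV (\<lambda>x. f (x - t *\<^sub>R e) * g x)" by (simp add: mult.commute)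
    have "\<exists>B>0. \<forall>x. \<bar>f (x - t *\<^sub>R e) * g x\<bar> \<le> B"
      by (rule bounded_compact_support[OF cc cK]) (simp add: g(2))
    then obtain C where "\<And>x. \<bar>f (x - t *\<^sub>R e) * g x\<bar> \<le> C" by auto
    then show "integrable ?L (\<lambda>x. f (x - t *\<^sub>R e) * g x)"
      by (intro ibd[of _ C] continuous_on_subset[OF cc]) auto
    show "(LINT x|?L. f x * g (x + t *\<^sub>R e)) = (LINT x|?L. f (x - t *\<^sub>R e) * g x)"
      by (rule integral_lebesgue_on_shift[OF assms(1) g(2) _ cc]) (use K t K\<Omega> in auto)
  qed
  have bound: "\<bar>D + I\<bar> \<le> \<epsilon> * (1 + (3 * B + 1) * N)" if \<epsilon>: "\<epsilon> > 0" for \<epsilon>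
  proof -
    obtain d1 where d1: "d1 > 0" "\<And>a b. a \<in> {-M..M} \<Longrightarrow> b \<in> {-M..M} \<Longrightarrow> \<bar>a - b\<bar> < d1 \<Longrightarrow> \<bar>m a b - \<Phi>' b\<bar> < \<epsilon>"
      using mu[OF \<epsilon>] by blast
    obtain d2 where d2: "d2 > 0" "\<And>x y. x \<in> closure \<Omega> \<Longrightarrow> y \<in> closure \<Omega> \<Longrightarrow> dist y x < d2 \<Longrightarrow> dist (w y) (w x) < d1"
      using ucw d1(1) unfolding uniformly_continuous_on_def by meson
    obtain d3 where d3: "d3 > 0" "\<And>x y. dist y x < d3 \<Longrightarrow> dist (g0 y) (g0 x) < \<epsilon>"
      using ug0 \<epsilon> unfolding uniformly_continuous_on_def by (meson UNIV_I)
    obtain d4 where d4: "d4 > 0" "\<And>h. h \<noteq> 0 \<Longrightarrow> \<bar>h\<bar> < d4 \<Longrightarrow> \<bar>(A h - A 0) / h - D\<bar> < \<epsilon>"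
      using tendstoD[OF lim \<epsilon>] unfolding eventually_at by (auto simp: dist_real_def)
    \<comment> \<open>Half the minimum makes the bounds strict. The four quantities are room for the
      support, closeness of the slope to \<Phi>' (\<open>d2\<close>, via \<open>d1\<close>),
      oscillation of \<open>g0\<close>, and closeness of the quotient of \<open>A\<close> to its
      derivative.\<close>
    define h where "h = Min {\<delta>, d2, d3, d4} / 2"
    have h: "h > 0" "h \<le> \<delta>" "h < d2" "h < d3" "h < d4"
    proof -
      have "Min {\<delta>, d2, d3, d4} > 0" using \<delta>(1) d2(1) d3(1) d4(1) by simp
      moreover have "Min {\<delta>, d2, d3, d4} \<le> \<delta>" "Min {\<delta>, d2, d3, d4} \<le> d2"
        "Min {\<delta>, d2, d3, d4} \<le> d3" "Min {\<delta>, d2, d3, d4} \<le> d4" by (auto intro!: Min_le)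
      ultimately show "h > 0" "h \<le> \<delta>" "h < d2" "h < d3" "h < d4" unfolding h_def by linarith+
    qed
    have close: "\<bar>gh h x - g0 x\<bar> \<le> B * \<epsilon>" for x
    proof (cases "x \<in> ?K")
      case True
      then have x: "x \<in> closure \<Omega>" "x - h *\<^sub>R e \<in> closure \<Omega>"
        using K[of x h] h K\<Omega> closure_subset[of \<Omega>] by auto
      have "dist (w (x - h *\<^sub>R e)) (w x) < d1"
        using x h e by (intro d2(2)) (auto simp: dist_norm)
      then have "\<bar>m (w (x - h *\<^sub>R e)) (w x) - \<Phi>' (w x)\<bar> < \<epsilon>"
        using M[OF x(1)] M[OF x(2)] by (intro d1(2)) (auto simp: dist_real_def)
      then have "\<bar>\<phi> x\<bar> * \<bar>m (w (x - h *\<^sub>R e)) (w x) - \<Phi>' (w x)\<bar> \<le> B * \<epsilon>"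
        using B by (intro mult_mono) auto
      then show ?thesis unfolding gh_def g0_def by (simp add: abs_mult flip: right_diff_distrib)
    next
      case False
      then show ?thesis using g0z ghz B(1) \<epsilon> by simp
    qed
    \<comment> \<open>Two passages between \<open>gh h\<close> and \<open>g0\<close> cost
      \<open>2 * B * \<epsilon>\<close>, the oscillation of \<open>g0\<close> one further
      \<epsilon>.\<close>
    have osc: "\<bar>gh h (x + t *\<^sub>R e) - gh h x\<bar> \<le> (2 * B + 1) * \<epsilon>" if "0 \<le> t" "t \<le> h" for x t
    proof -
      have "dist (g0 (x + t *\<^sub>R e)) (g0 x) < \<epsilon>"
        using that h e by (intro d3(2)) (auto simp: dist_norm)
      then show ?thesis using close[of x] close[of "x + t *\<^sub>R e"]
        unfolding dist_real_def by (simp add: algebra_simps)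
    qed
    have c\<Phi>w: "continuous_on \<Omega> (\<lambda>x. \<Phi> (w x))" by (rule continuous_on_compose2[OF c\<Phi> cw\<Omega>]) simp
    have \<phi>z: "\<phi> x = 0" if "x \<notin> ?K" for x using that by (rule test_function_zero)
    note ish\<Phi> = ishift[OF _ _ c\<phi> \<phi>z c\<Phi>w]
    have h0: "0 \<le> h" "(0::real) \<le> 0" "0 \<le> \<delta>" using h \<delta>(1) by auto
    note ishw = ishift[OF _ _ cgh[OF h0(1) h(2)] ghz cw\<Omega>]
    \<comment> \<open>The unshifted integral is written with \<open>0 *\<^sub>R e\<close> so that
      \<open>ishift\<close> at \<open>t = 0\<close> applies to it literally.\<close>
    have "A h - A 0 = (LINT x|?L. \<Phi> (w (x - h *\<^sub>R e)) * \<phi> x) - (LINT x|?L. \<Phi> (w (x - 0 *\<^sub>R e)) * \<phi> x)"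
      unfolding A_def by (rule arg_cong2[where f = "(-)", OF ish\<Phi>(2)[OF h0(1) h(2)] ish\<Phi>(2)[OF h0(2,3)]])
    also have "\<dots> = (LINT x|?L. \<Phi> (w (x - h *\<^sub>R e)) * \<phi> x - \<Phi> (w (x - 0 *\<^sub>R e)) * \<phi> x)"
      by (rule Bochner_Integration.integral_diff[OF ish\<Phi>(1)[OF h0(1) h(2)] ish\<Phi>(1)[OF h0(2,3)], symmetric])
    \<comment> \<open>Here \<Phi> is linearised exactly: its increment between the two values of
      \<open>w\<close> is the slope times the increment of \<open>w\<close>, and \<phi> times the
      slope is \<open>gh h\<close>.\<close>
    also have "\<dots> = (LINT x|?L. w (x - h *\<^sub>R e) * gh h x - w (x - 0 *\<^sub>R e) * gh h x)"
    proof (rule Bochner_Integration.integral_cong)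
      fix x
      show "\<Phi> (w (x - h *\<^sub>R e)) * \<phi> x - \<Phi> (w (x - 0 *\<^sub>R e)) * \<phi> x
          = w (x - h *\<^sub>R e) * gh h x - w (x - 0 *\<^sub>R e) * gh h x"
        using arg_cong[OF m(3)[of "w x" "w (x - h *\<^sub>R e)"], of "\<lambda>r. r * \<phi> x"]
          m(3)[of "w (x - h *\<^sub>R e)" "w x"]
        unfolding gh_def by (simp add: algebra_simps)
    qed simp
    also have "\<dots> = (LINT x|?L. w (x - h *\<^sub>R e) * gh h x) - (LINT x|?L. w (x - 0 *\<^sub>R e) * gh h x)"
      by (rule Bochner_Integration.integral_diff[OF ishw(1)[OF h0(1) h(2)] ishw(1)[OF h0(2,3)]])
    also have "\<dots> = (LINT x|?L. w x * gh h (x + h *\<^sub>R e)) - (LINT x|?L. w x * gh h (x + 0 *\<^sub>R e))"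
      by (rule arg_cong2[where f = "(-)", OF ishw(2)[OF h0(1) h(2), symmetric] ishw(2)[OF h0(2,3), symmetric]])
    also have "\<dots> = (LINT x|?L. w x * (gh h (x + h *\<^sub>R e) - gh h x))"
    proof -
      have "\<exists>B>0. \<forall>x. \<bar>gh h x\<bar> \<le> B"
        by (rule bounded_compact_support[OF cgh cK ghz]) (use h in auto)
      then obtain C where C: "\<And>x. \<bar>gh h x\<bar> \<le> C" by auto
      have cs: "continuous_on \<Omega> (\<lambda>x. gh h (x + a))" for a
        by (rule continuous_on_compose2[OF cgh]) (use h in \<open>auto intro: continuous_intros\<close>)
      have "integrable ?L (\<lambda>x. w x * gh h (x + a))" for a
        by (rule integrable_mult_bounded_continuous[OF assms(1) iw cs C])
      from this[of "h *\<^sub>R e"] this[of 0] show ?thesis by (simp add: right_diff_distrib)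
    qed
    finally have AA: "A h - A 0 = (LINT x|?L. w x * (gh h (x + h *\<^sub>R e) - gh h x))" .
    define J where "J = (LINT x|?L. (G x \<bullet> e) * gh h x)"
    have "\<bar>(A h - A 0) + h * J\<bar> \<le> h * ((2 * B + 1) * \<epsilon>) * N"
      unfolding AA J_def N_def
      by (rule weak_difference_quotient_bound[OF assms(1) iw iG H tf e h(1) _ cmh _ osc])
         (use K h in \<open>auto simp: gh_def\<close>)
    then have "\<bar>(A h - A 0) + h * J\<bar> / h \<le> (2 * B + 1) * \<epsilon> * N"
      using h(1) by (simp add: divide_le_eq mult_ac)
    moreover have "(A h - A 0) / h + J = ((A h - A 0) + h * J) / h"
      using h(1) by (simp add: add_divide_distrib)
    ultimately have 1: "\<bar>(A h - A 0) / h + J\<bar> \<le> (2 * B + 1) * \<epsilon> * N"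
      using h(1) by simp
    have "\<bar>LINT x|?L. (G x \<bullet> e) * (gh h x - g0 x)\<bar> \<le> B * \<epsilon> * N"
      unfolding N_def using h
      by (intro abs_integral_mult_le[OF assms(1) iG _ close] continuous_on_diff
          continuous_on_subset[OF cgh] continuous_on_subset[OF cg0]) auto
    moreover have "(LINT x|?L. (G x \<bullet> e) * (gh h x - g0 x)) = J - I"
    proof -
      have "\<exists>B>0. \<forall>x. \<bar>gh h x\<bar> \<le> B"
        by (rule bounded_compact_support[OF cgh cK ghz]) (use h in auto)
      then obtain C where C: "\<And>x. \<bar>gh h x\<bar> \<le> C" by auto
      have "\<exists>B>0. \<forall>x. \<bar>g0 x\<bar> \<le> B"
        by (rule bounded_compact_support[OF cg0 cK g0z])
      then obtain C' where C': "\<And>x. \<bar>g0 x\<bar> \<le> C'" by auto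
      have "integrable ?L (\<lambda>x. (G x \<bullet> e) * gh h x)"
        using h by (intro integrable_mult_bounded_continuous[OF assms(1) iG _ C] continuous_on_subset[OF cgh]) auto
      moreover have "integrable ?L (\<lambda>x. (G x \<bullet> e) * g0 x)"
        by (intro integrable_mult_bounded_continuous[OF assms(1) iG _ C'] continuous_on_subset[OF cg0]) auto
      ultimately show ?thesis unfolding J_def I_def by (simp add: right_diff_distrib)
    qed
    ultimately have 2: "\<bar>J - I\<bar> \<le> B * \<epsilon> * N" by simp
    have 3: "\<bar>(A h - A 0) / h - D\<bar> < \<epsilon>" using d4(2)[of h] h by simp
    \<comment> \<open>The three errors are: quotient of \<open>A\<close> against \<open>D\<close>,
      weak difference quotient against \<open>J\<close>, and \<open>J\<close> against
      \<open>I\<close>. Their coefficients do not depend on \<epsilon> or \<open>h\<close>.\<close>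
    have "\<bar>D + I\<bar> \<le> \<epsilon> + (2 * B + 1) * \<epsilon> * N + B * \<epsilon> * N"
      using 1 2 3 by linarith
    also have "\<dots> = \<epsilon> * (1 + (3 * B + 1) * N)" by (simp add: algebra_simps)
    finally show ?thesis .
  qed
  define C where "C = 1 + (3 * B + 1) * N"
  have "C > 0" unfolding C_def using N0 B(1) by (intro add_pos_nonneg mult_nonneg_nonneg) auto
  have "\<bar>D + I\<bar> \<le> 0 + \<epsilon>" if "\<epsilon> > 0" for \<epsilon>
    using bound[of "\<epsilon> / C"] \<open>C > 0\<close> that unfolding C_def[symmetric] by simp
  then have "\<bar>D + I\<bar> \<le> 0" by (rule field_le_epsilon)
  then show ?thesis unfolding D_def I_def g0_def by linarith
qed


section \<open>Square integrability and the chain rule in \<open>H1_gradient\<close>\<close>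

lemma square_integrable_scaleR_bounded:
  assumes "square_integrable M G" "b \<in> borel_measurable M" "\<And>x. x \<in> space M \<Longrightarrow> \<bar>b x\<bar> \<le> C"
  shows "square_integrable M (\<lambda>x. b x *\<^sub>R G x)"
proof -
  have G: "G \<in> borel_measurable M" "integrable M (\<lambda>x. (norm (G x))\<^sup>2)"
    using assms(1) unfolding square_integrable_def by auto
  have m: "(\<lambda>x. b x *\<^sub>R G x) \<in> borel_measurable M"
    by (rule borel_measurable_scaleR[OF assms(2) G(1)])
  have "integrable M (\<lambda>x. (norm (b x *\<^sub>R G x))\<^sup>2)"
  proof (rule Bochner_Integration.integrable_bound)
    show "integrable M (\<lambda>x. C\<^sup>2 * (norm (G x))\<^sup>2)" using G(2) by simp
    show "(\<lambda>x. (norm (b x *\<^sub>R G x))\<^sup>2) \<in> borel_measurable M" using m by measurable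
    show "AE x in M. norm ((norm (b x *\<^sub>R G x))\<^sup>2) \<le> norm (C\<^sup>2 * (norm (G x))\<^sup>2)"
    proof (rule AE_I2)
      fix x assume "x \<in> space M"
      then have "\<bar>b x\<bar>\<^sup>2 \<le> C\<^sup>2" by (intro power_mono assms(3)) auto
      then show "norm ((norm (b x *\<^sub>R G x))\<^sup>2) \<le> norm (C\<^sup>2 * (norm (G x))\<^sup>2)"
        by (simp add: power_mult_distrib mult_right_mono)
    qed
  qed
  then show ?thesis unfolding square_integrable_def using m by blast
qed

lemma square_integrable_bounded:
  fixes f :: "'a \<Rightarrow> real"
  assumes "finite_measure M" "f \<in> borel_measurable M" "\<And>x. x \<in> space M \<Longrightarrow> \<bar>f x\<bar> \<le> C"
  shows "square_integrable M f"
proof -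
  have "square_integrable M (\<lambda>_. 1 :: real)"
    unfolding square_integrable_def using assms(1) by (simp add: finite_measure.integrable_const)
  from square_integrable_scaleR_bounded[OF this assms(2,3)] show ?thesis by simp
qed

lemma bounded_on_closure:
  fixes f :: "'a::euclidean_space \<Rightarrow> real"
  assumes "bounded \<Omega>" "continuous_on (closure \<Omega>) f"
  obtains C where "\<And>x. x \<in> closure \<Omega> \<Longrightarrow> \<bar>f x\<bar> \<le> C"
proof -
  have "bounded (f ` closure \<Omega>)"
    using assms by (intro compact_imp_bounded compact_continuous_image) auto
  then show ?thesis using that unfolding bounded_iff by auto
qed

lemma square_integrable_continuous_closure:
  fixes f :: "'a::euclidean_space \<Rightarrow> real"
  assumes "open \<Omega>" "bounded \<Omega>" "continuous_on (closure \<Omega>) f"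
  shows "square_integrable (lebesgue_on \<Omega>) f"
proof -
  obtain C where C: "\<And>x. x \<in> closure \<Omega> \<Longrightarrow> \<bar>f x\<bar> \<le> C"
    using bounded_on_closure[OF assms(2,3)] by metis
  show ?thesis
  proof (rule square_integrable_bounded[OF finite_measure_lebesgue_on_bounded_open[OF assms(1,2)]])
    show "f \<in> borel_measurable (lebesgue_on \<Omega>)"
      using assms(1) continuous_on_subset[OF assms(3) closure_subset]
      by (intro continuous_imp_measurable_on_sets_lebesgue) auto
    show "\<bar>f x\<bar> \<le> C" if "x \<in> space (lebesgue_on \<Omega>)" for x
      using C[of x] that closure_subset[of \<Omega>] by auto
  qed
qed

text \<open>The weak identity is already available; what remains is square integrability. Since
  \<open>w\<close> is continuous on the compact closure, \<Phi> and \<Phi>' only see a compact range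
  and no global bound on them is required.\<close>

lemma H1_gradient_chain_rule:
  fixes \<Omega> :: "'a::euclidean_space set"
  assumes "open \<Omega>" "bounded \<Omega>" and cw: "continuous_on (closure \<Omega>) w" and H: "H1_gradient \<Omega> w G"
    and d: "\<And>t. (\<Phi> has_real_derivative \<Phi>' t) (at t)" and c': "continuous_on UNIV \<Phi>'"
  shows "H1_gradient \<Omega> (\<lambda>x. \<Phi> (w x)) (\<lambda>x. \<Phi>' (w x) *\<^sub>R G x)"
proof -
  have c\<Phi>: "continuous_on UNIV \<Phi>"
    by (rule DERIV_continuous_on) (rule has_field_derivative_at_within[OF d])
  have "square_integrable (lebesgue_on \<Omega>) (\<lambda>x. \<Phi> (w x))"
    by (intro square_integrable_continuous_closure assms(1,2) continuous_on_compose2[OF c\<Phi> cw]) simp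
  moreover have "square_integrable (lebesgue_on \<Omega>) (\<lambda>x. \<Phi>' (w x) *\<^sub>R G x)"
  proof -
    have cc: "continuous_on (closure \<Omega>) (\<lambda>x. \<Phi>' (w x))"
      by (intro continuous_on_compose2[OF c' cw]) simp
    obtain C where C: "\<And>x. x \<in> closure \<Omega> \<Longrightarrow> \<bar>\<Phi>' (w x)\<bar> \<le> C"
      using bounded_on_closure[OF assms(2) cc] by metis
    show ?thesis
    proof (rule square_integrable_scaleR_bounded)
      show "square_integrable (lebesgue_on \<Omega>) G" using H unfolding H1_gradient_def by blast
      show "(\<lambda>x. \<Phi>' (w x)) \<in> borel_measurable (lebesgue_on \<Omega>)"
        using square_integrable_continuous_closure[OF assms(1,2) cc] unfolding square_integrable_def by blast
      show "\<bar>\<Phi>' (w x)\<bar> \<le> C" if "x \<in> space (lebesgue_on \<Omega>)" for x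
        using C[of x] that closure_subset[of \<Omega>] by auto
    qed
  qed
  moreover have "(LINT x|lebesgue_on \<Omega>. \<Phi> (w x) * frechet_derivative \<phi> (at x) i) =
        - (LINT x|lebesgue_on \<Omega>. ((\<Phi>' (w x) *\<^sub>R G x) \<bullet> i) * \<phi> x)"
    if "test_function \<Omega> \<phi>" "i \<in> Basis" for \<phi> i
    unfolding weak_derivative_chain_rule[OF assms that]
    by (simp add: algebra_simps)
  ultimately show ?thesis unfolding H1_gradient_def by blast
qed

subsection \<open>Finiteness of the surface measure\<close>

text \<open>Box counting through \<open>d\<close> coordinates \<open>T\<close> that separate points
  of \<open>A\<close> in a Lipschitz way: at scale \<open>s\<close> there are of order
  \<open>s\<close> to the power \<open>-d\<close> cells, each of diameter at most
  \<open>C * s\<close>, so the total weight is bounded independently of the scale. Quantifying over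
  every \<open>D > 0\<close> instead of a maximum over \<open>J\<close> also serves empty
  \<open>J\<close>: the assumption then says that \<open>A\<close> has at most one point.\<close>

lemma hausdorff_outer_measure_finite:
  fixes A :: "'a::euclidean_space set" and T :: "'a \<Rightarrow> 'i \<Rightarrow> real"
  assumes J: "finite J" "card J = d" and "C > 0" and "bounded A"
    and R: "R \<ge> 0" "\<And>x j. x \<in> A \<Longrightarrow> j \<in> J \<Longrightarrow> \<bar>T x j\<bar> \<le> R"
    and lip: "\<And>x y D. x \<in> A \<Longrightarrow> y \<in> A \<Longrightarrow> D > 0 \<Longrightarrow> (\<And>j. j \<in> J \<Longrightarrow> \<bar>T x j - T y j\<bar> \<le> D) \<Longrightarrow> dist x y \<le> C * D"
  shows "hausdorff_outer_measure d A < \<infinity>"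
proof -
  define K where "K = unit_ball_vol (real d) * ((R + 1) * C) ^ d"
  have "hausdorff_premeasure d \<delta> A \<le> ennreal K" if "\<delta> > 0" for \<delta>
  proof -
    \<comment> \<open>\<open>C * s \<le> \<delta>\<close> makes the cells admissible for the
      premeasure; \<open>s \<le> 1\<close> turns the count \<open>2 * (R / s) + 2\<close> into the
      scale-free bound \<open>2 * (R + 1)\<close> after multiplication by \<open>s\<close>.\<close>
    define s where "s = min 1 (\<delta> / C)"
    have s: "s > 0" "s \<le> 1" "C * s \<le> \<delta>"
      using \<open>\<delta> > 0\<close> \<open>C > 0\<close> by (auto simp: s_def min_def field_simps)
    define I where "I = {\<lfloor>- (R / s)\<rfloor>..\<lfloor>R / s\<rfloor>}"
    define P where "P = Pi\<^sub>E J (\<lambda>_. I)"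
    define n where "n = card P"
    have "finite P" unfolding P_def I_def using J(1) by (intro finite_PiE) auto
    have cP: "n = card I ^ d" unfolding n_def P_def using J by (simp add: card_PiE)
    have "real (card I) \<le> 2 * (R / s) + 2"
    proof -
      have "\<lfloor>- (R / s)\<rfloor> \<le> \<lfloor>R / s\<rfloor>" using R(1) s(1) by (intro floor_mono) simp
      then have "real (card I) = of_int (\<lfloor>R / s\<rfloor> - \<lfloor>- (R / s)\<rfloor> + 1)" unfolding I_def by simp
      then show ?thesis by linarith
    qed
    then have "real (card I) * s \<le> (2 * (R / s) + 2) * s" using s(1) by (intro mult_right_mono) auto
    also have "\<dots> \<le> 2 * (R + 1)" using s by (simp add: field_simps)
    finally have cI: "real (card I) * (C * s / 2) \<le> (R + 1) * C"
      using mult_right_mono[of "real (card I) * s" "2 * (R + 1)" "C / 2"] \<open>C > 0\<close> by (simp add: field_simps)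
    define Q where "Q k = {x \<in> A. \<forall>j\<in>J. \<lfloor>T x j / s\<rfloor> = k j}" for k :: "'i \<Rightarrow> int"
    have dQ: "dist x y \<le> C * s" if "x \<in> Q k" "y \<in> Q k" for x y k
    proof (rule lip)
      show "x \<in> A" "y \<in> A" "s > 0" using that s unfolding Q_def by auto
      fix j assume "j \<in> J"
      then have "\<lfloor>T x j / s\<rfloor> = \<lfloor>T y j / s\<rfloor>" using that unfolding Q_def by auto
      then have "\<bar>T x j / s - T y j / s\<bar> \<le> 1" by linarith
      then have "\<bar>T x j - T y j\<bar> / s \<le> 1" using s(1) by (simp flip: diff_divide_distrib)
      then show "\<bar>T x j - T y j\<bar> \<le> s" using s(1) by simp
    qed
    have diam: "diameter (Q k) \<le> C * s" for k
      using dQ s(1) \<open>C > 0\<close> by (intro diameter_le) (auto simp: dist_norm)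
    obtain ix where ix: "bij_betw ix {0..<n} P"
      using ex_bij_betw_nat_finite[OF \<open>finite P\<close>] unfolding n_def by blast
    \<comment> \<open>The finite family is padded with empty sets, whose weight is 0 even when
      \<open>d = 0\<close>.\<close>
    define c where "c i = (if i < n then Q (ix i) else {})" for i
    have "A \<subseteq> (\<Union>i. c i)"
    proof
      fix x assume x: "x \<in> A"
      define k where "k = restrict (\<lambda>j. \<lfloor>T x j / s\<rfloor>) J"
      have "\<lfloor>T x j / s\<rfloor> \<in> I" if "j \<in> J" for j
      proof -
        have "- R \<le> T x j" "T x j \<le> R" using R(2)[OF x that] by auto
        then have "- (R / s) \<le> T x j / s" "T x j / s \<le> R / s"
          using s(1) by (auto simp: field_simps)
        then show ?thesis unfolding I_def by (auto intro: floor_mono)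
      qed
      then have "k \<in> P" unfolding P_def k_def by auto
      then obtain i where "i < n" "ix i = k" using ix unfolding bij_betw_def by force
      moreover have "x \<in> Q k" unfolding Q_def k_def using x by auto
      ultimately have "x \<in> c i" unfolding c_def by simp
      then show "x \<in> (\<Union>i. c i)" by blast
    qed
    moreover have "bounded (c i) \<and> diameter (c i) \<le> \<delta>" for i
      using diam[of "ix i"] s(3) \<open>\<delta> > 0\<close> bounded_subset[OF \<open>bounded A\<close>, of "Q (ix i)"]
      by (auto simp: c_def Q_def)
    ultimately have "hausdorff_premeasure d \<delta> A \<le> (\<Sum>i. hausdorff_weight d (c i))"
      unfolding hausdorff_premeasure_def by (intro INF_lower) auto
    also have "\<dots> = (\<Sum>i<n. hausdorff_weight d (c i))"
      by (rule suminf_finite) (auto simp: c_def hausdorff_weight_def)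
    also have "\<dots> \<le> (\<Sum>i<n. ennreal (unit_ball_vol (real d) * (C * s / 2) ^ d))"
    proof (rule sum_mono)
      fix i assume "i \<in> {..<n}"
      then show "hausdorff_weight d (c i) \<le> ennreal (unit_ball_vol (real d) * (C * s / 2) ^ d)"
        using diam[of "ix i"] diameter_ge_0[OF bounded_subset[OF \<open>bounded A\<close>, of "Q (ix i)"]]
        unfolding hausdorff_weight_def c_def Q_def
        by (auto intro!: ennreal_leI mult_left_mono power_mono divide_right_mono)
    qed
    also have "\<dots> = ennreal (real n * (unit_ball_vol (real d) * (C * s / 2) ^ d))"
      by (simp add: ennreal_mult ennreal_of_nat_eq_real_of_nat \<open>C > 0\<close> less_imp_le s(1))
    also have "\<dots> \<le> ennreal K"
    proof (rule ennreal_leI)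
      have "real n * (C * s / 2) ^ d = (real (card I) * (C * s / 2)) ^ d"
        unfolding cP by (simp only: power_mult_distrib of_nat_power)
      also have "\<dots> \<le> ((R + 1) * C) ^ d" using cI \<open>C > 0\<close> s(1) by (intro power_mono) auto
      finally show "real n * (unit_ball_vol (real d) * (C * s / 2) ^ d) \<le> K"
        unfolding K_def using mult_left_mono[of _ _ "unit_ball_vol (real d)"] by (simp add: mult_ac)
    qed
    finally show ?thesis .
  qed
  then have "hausdorff_outer_measure d A \<le> ennreal K"
    unfolding hausdorff_outer_measure_def by (intro SUP_least) auto
  then show ?thesis by (rule le_less_trans) simp
qed

text \<open>Smoothness gives continuity of the derivative only in each fixed direction. Bounding the
  finitely many partial derivatives on the compact ball bounds the operator norm by their sum, and
  convexity of the ball yields the Lipschitz estimate.\<close>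

lemma smooth_imp_lipschitz_on_cball:
  fixes h :: "'a::euclidean_space \<Rightarrow> real"
  assumes "smooth h"
  obtains L where "L \<ge> 0" "\<And>x y. x \<in> cball 0 \<rho> \<Longrightarrow> y \<in> cball 0 \<rho> \<Longrightarrow> \<bar>h x - h y\<bar> \<le> L * norm (x - y)"
proof -
  let ?D = "\<lambda>x. frechet_derivative h (at x)"
  have "\<exists>B. \<forall>x\<in>cball 0 \<rho>. \<bar>?D x i\<bar> \<le> B" for i
  proof -
    have "continuous_on (cball 0 \<rho>) (\<lambda>x. ?D x i)"
      by (rule continuous_on_subset[OF smooth_continuous[OF smooth_derivative[OF assms]]]) simp
    then have "bounded ((\<lambda>x. ?D x i) ` cball 0 \<rho>)"
      by (intro compact_imp_bounded compact_continuous_image) auto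
    then show ?thesis unfolding bounded_iff by auto
  qed
  then obtain B where B: "\<And>i x. x \<in> cball 0 \<rho> \<Longrightarrow> \<bar>?D x i\<bar> \<le> B i" by metis
  have dh: "(h has_derivative ?D x) (at x)" for x
    using smooth_differentiable[OF assms] frechet_derivative_works by blast
  define L where "L = (\<Sum>i\<in>Basis. \<bar>B i\<bar>)"
  have "onorm (?D x) \<le> L" if x: "x \<in> cball 0 \<rho>" for x
  proof (rule onorm_bound)
    show "0 \<le> L" unfolding L_def by (simp add: sum_nonneg)
    fix v
    have lin: "linear (?D x)" using dh has_derivative_linear by blast
    have "?D x v = ?D x (\<Sum>i\<in>Basis. (v \<bullet> i) *\<^sub>R i)" by (simp add: euclidean_representation)
    also have "\<dots> = (\<Sum>i\<in>Basis. (v \<bullet> i) * ?D x i)"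
      by (simp add: linear_sum[OF lin] linear_scale[OF lin])
    finally have "norm (?D x v) \<le> (\<Sum>i\<in>Basis. \<bar>(v \<bullet> i) * ?D x i\<bar>)"
      by (simp add: sum_abs)
    also have "\<dots> \<le> (\<Sum>i\<in>Basis. norm v * \<bar>B i\<bar>)"
    proof (rule sum_mono)
      fix i :: 'a assume "i \<in> Basis"
      moreover have "\<bar>?D x i\<bar> \<le> \<bar>B i\<bar>" using B[OF x, of i] by linarith
      ultimately show "\<bar>(v \<bullet> i) * ?D x i\<bar> \<le> norm v * \<bar>B i\<bar>"
        unfolding abs_mult by (intro mult_mono Basis_le_norm) auto
    qed
    finally show "norm (?D x v) \<le> L * norm v" by (simp add: L_def sum_distrib_left mult.commute)
  qed
  then have "norm (h x - h y) \<le> L * norm (x - y)" if "x \<in> cball 0 \<rho>" "y \<in> cball 0 \<rho>" for x y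
    using that by (intro differentiable_bound[of "cball 0 \<rho>" h ?D] has_derivative_at_withinI[OF dh]) auto
  moreover have "L \<ge> 0" unfolding L_def by (simp add: sum_nonneg)
  ultimately show ?thesis using that by simp
qed

text \<open>A graph point is determined by its projection \<open>P x\<close> to the hyperplane
  orthogonal to \<open>e\<close>. Instead of an orthonormal basis of that hyperplane, the standard
  coordinates of \<open>P x\<close> are used with one dropped, chosen so that \<open>e\<close> has a
  nonzero component there.\<close>

lemma hausdorff_outer_measure_graph_finite:
  fixes h :: "'a::euclidean_space \<Rightarrow> real"
  assumes "smooth h" and e: "norm e = 1" and "bounded A"
    and A: "\<And>x. x \<in> A \<Longrightarrow> h (x - (x \<bullet> e) *\<^sub>R e) = x \<bullet> e"
  shows "hausdorff_outer_measure (DIM('a) - 1) A < \<infinity>"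
proof -
  define P where "P x = x - (x \<bullet> e) *\<^sub>R e" for x
  obtain \<rho> where \<rho>: "\<rho> > 0" "\<And>x. x \<in> A \<Longrightarrow> norm x \<le> \<rho>" using \<open>bounded A\<close> unfolding bounded_pos by auto
  have Pn: "norm (P x) \<le> 2 * \<rho>" if "x \<in> A" for x
  proof -
    have "norm (P x) \<le> norm x + norm ((x \<bullet> e) *\<^sub>R e)" unfolding P_def by (rule norm_triangle_ineq4)
    moreover have "norm ((x \<bullet> e) *\<^sub>R e) \<le> norm x" using e Cauchy_Schwarz_ineq2[of x e] by simp
    ultimately show ?thesis using \<rho>(2)[OF that] by linarith
  qed
  obtain L where L: "L \<ge> 0" "\<And>x y. x \<in> cball 0 (2 * \<rho>) \<Longrightarrow> y \<in> cball 0 (2 * \<rho>) \<Longrightarrow> \<bar>h x - h y\<bar> \<le> L * norm (x - y)"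
    using smooth_imp_lipschitz_on_cball[OF assms(1), of "2 * \<rho>"] by metis
  obtain i where i: "i \<in> Basis" "e \<bullet> i \<noteq> 0"
    using e euclidean_all_zero_iff[of e] by auto
  \<comment> \<open>\<open>C1 * D\<close> bounds a hyperplane vector whose retained coordinates are
    at most \<open>D\<close>: the term 1 accounts for those, the term with
    \<open>e \<bullet> i\<close> for the dropped coordinate. In \<open>C\<close>, the factor
    \<open>1 + L\<close> adds the height difference and the final \<open>+ 1\<close> secures
    positivity.\<close>
  define C1 where "C1 = real DIM('a) * (1 + 1 / \<bar>e \<bullet> i\<bar>)"
  have C1: "C1 \<ge> 0" unfolding C1_def by simp
  define C where "C = (1 + L) * C1 + 1"
  have C: "C > 0" unfolding C_def using L(1) C1 by (intro add_nonneg_pos) auto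
  show ?thesis
  proof (rule hausdorff_outer_measure_finite[where J = "Basis - {i}" and T = "\<lambda>x j. P x \<bullet> j" and C = C and R = "2 * \<rho>"])
    show "finite (Basis - {i})" "card (Basis - {i}) = DIM('a) - 1" "C > 0" "bounded A" "0 \<le> 2 * \<rho>"
      using i(1) C \<open>bounded A\<close> \<rho>(1) by auto
    show "\<bar>P x \<bullet> j\<bar> \<le> 2 * \<rho>" if "x \<in> A" "j \<in> Basis - {i}" for x j
      using that Pn[of x] Basis_le_norm[of j "P x"] by auto
    fix x y D assume xy: "x \<in> A" "y \<in> A" and D: "D > 0"
      and le: "\<And>j. j \<in> Basis - {i} \<Longrightarrow> \<bar>P x \<bullet> j - P y \<bullet> j\<bar> \<le> D"
    define z where "z = P x - P y"
    have zj: "\<bar>z \<bullet> j\<bar> \<le> D" if "j \<in> Basis - {i}" for j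
      using le[OF that] unfolding z_def by (simp add: inner_diff_left)
    have cb: "real (card (Basis - {i} :: 'a set)) \<le> real DIM('a)"
      by (simp add: card_mono)
    \<comment> \<open>Orthogonality to \<open>e\<close> is the linear equation that recovers the
      dropped coordinate of \<open>z\<close> from the others.\<close>
    have "z \<bullet> e = 0" unfolding z_def P_def
      using e by (simp add: inner_diff_left power2_norm_eq_inner[symmetric])
    then have "(z \<bullet> i) * (e \<bullet> i) + (\<Sum>j\<in>Basis - {i}. (z \<bullet> j) * (e \<bullet> j)) = 0"
      unfolding euclidean_inner[of z e] using i(1) by (simp add: sum.remove)
    then have "\<bar>z \<bullet> i\<bar> * \<bar>e \<bullet> i\<bar> = \<bar>\<Sum>j\<in>Basis - {i}. (z \<bullet> j) * (e \<bullet> j)\<bar>"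
      unfolding abs_mult[symmetric] by linarith
    also have "\<dots> \<le> (\<Sum>j\<in>Basis - {i}. \<bar>(z \<bullet> j) * (e \<bullet> j)\<bar>)" by (rule sum_abs)
    also have "\<dots> \<le> (\<Sum>j\<in>Basis - {i}. D * 1)"
    proof (rule sum_mono)
      fix j assume j: "j \<in> Basis - {i}"
      then have "\<bar>e \<bullet> j\<bar> \<le> 1" using Basis_le_norm[of j e] e by auto
      then show "\<bar>(z \<bullet> j) * (e \<bullet> j)\<bar> \<le> D * 1"
        unfolding abs_mult using zj[OF j] by (intro mult_mono) auto
    qed
    also have "\<dots> \<le> real DIM('a) * D" using cb D by simp
    finally have zi: "\<bar>z \<bullet> i\<bar> \<le> real DIM('a) * D / \<bar>e \<bullet> i\<bar>" using i(2) by (simp add: field_simps)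
    have "norm z \<le> (\<Sum>j\<in>Basis. \<bar>z \<bullet> j\<bar>)" by (rule norm_le_l1)
    also have "\<dots> = \<bar>z \<bullet> i\<bar> + (\<Sum>j\<in>Basis - {i}. \<bar>z \<bullet> j\<bar>)" using i(1) by (simp add: sum.remove)
    also have "(\<Sum>j\<in>Basis - {i}. \<bar>z \<bullet> j\<bar>) \<le> real (card (Basis - {i})) * D"
      using zj by (intro sum_bounded_above) auto
    also have "\<dots> \<le> real DIM('a) * D" using cb D by simp
    finally have nz: "norm z \<le> C1 * D" using zi unfolding C1_def by (simp add: algebra_simps)
    have "x - y = z + (x \<bullet> e - y \<bullet> e) *\<^sub>R e" unfolding z_def P_def by (simp add: algebra_simps)
    then have "dist x y \<le> norm z + \<bar>x \<bullet> e - y \<bullet> e\<bar>"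
      using norm_triangle_ineq[of z "(x \<bullet> e - y \<bullet> e) *\<^sub>R e"] e by (simp add: dist_norm)
    also have "\<bar>x \<bullet> e - y \<bullet> e\<bar> = \<bar>h (P x) - h (P y)\<bar>" using A xy unfolding P_def by simp
    also have "\<dots> \<le> L * norm z" unfolding z_def using Pn xy by (intro L(2)) auto
    also have "norm z + L * norm z = (1 + L) * norm z" by (simp add: algebra_simps)
    also have "\<dots> \<le> (1 + L) * (C1 * D)" using L(1) nz by (intro mult_left_mono) auto
    also have "\<dots> \<le> C * D" unfolding C_def using D by (simp add: algebra_simps)
    finally show "dist x y \<le> C * D" by simp
  qed
qed

section \<open>From local graphs to the whole boundary\<close>

lemma sets_hausdorff_measure [simp]: "sets (hausdorff_measure d) = sets borel"
  unfolding hausdorff_measure_def using sets.sigma_sets_eq[of borel] by (simp add: sets_measure_of_conv)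

lemma space_hausdorff_measure [simp]: "space (hausdorff_measure d) = UNIV"
  unfolding hausdorff_measure_def by (simp add: space_measure_of_conv)

text \<open>If the outer measure failed to be countably additive, \<^const>\<open>measure_of\<close> would return the
  zero measure, so the inequality needs no Caratheodory argument.\<close>

lemma emeasure_hausdorff_measure_le: "emeasure (hausdorff_measure d) A \<le> hausdorff_outer_measure d A"
  unfolding hausdorff_measure_def emeasure_measure_of_conv by simp

text \<open>The chart describes \<Omega>, not its boundary. Points with \<open>h\<close> below
  \<open>x \<bullet> e\<close> are in the open set \<Omega> and so not on the frontier; points with
  \<open>h\<close> above have a neighbourhood that misses \<Omega>. Only the graph remains.\<close>

lemma frontier_locally_finite:
  fixes \<Omega> :: "'a::euclidean_space set"
  assumes "open \<Omega>" "smooth_boundary \<Omega>" "p \<in> frontier \<Omega>"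
  shows "\<exists>r>0. hausdorff_outer_measure (DIM('a) - 1) (frontier \<Omega> \<inter> ball p r) < \<infinity>"
proof -
  obtain r e h where r: "r > 0" and e: "norm e = 1" and h: "smooth h"
    and eq: "\<Omega> \<inter> ball p r = {x \<in> ball p r. h (x - (x \<bullet> e) *\<^sub>R e) < x \<bullet> e}"
    using assms(2,3) unfolding smooth_boundary_def by blast
  have c: "continuous_on UNIV (\<lambda>x. h (x - (x \<bullet> e) *\<^sub>R e))"
    by (rule continuous_on_compose2[OF smooth_continuous[OF h]]) (auto intro!: continuous_intros)
  have "h (x - (x \<bullet> e) *\<^sub>R e) = x \<bullet> e" if x: "x \<in> frontier \<Omega> \<inter> ball p r" for x
  proof (rule linorder_cases[of "h (x - (x \<bullet> e) *\<^sub>R e)" "x \<bullet> e"])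
    assume "h (x - (x \<bullet> e) *\<^sub>R e) < x \<bullet> e"
    then have "x \<in> \<Omega>" using x eq by blast
    then show ?thesis using x assms(1) by (simp add: frontier_def interior_open)
  next
    assume gt: "h (x - (x \<bullet> e) *\<^sub>R e) > x \<bullet> e"
    let ?U = "ball p r \<inter> {x. x \<bullet> e < h (x - (x \<bullet> e) *\<^sub>R e)}"
    have "open ?U"
      by (intro open_Int open_ball open_Collect_less c) (auto intro!: continuous_intros)
    moreover have "x \<in> ?U" "x \<in> closure \<Omega>" using x gt by (auto simp: frontier_def)
    ultimately have "?U \<inter> \<Omega> \<noteq> {}" using open_Int_closure_eq_empty by blast
    then obtain y where y: "y \<in> ball p r" "y \<bullet> e < h (y - (y \<bullet> e) *\<^sub>R e)" "y \<in> \<Omega>" by blast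
    then have "h (y - (y \<bullet> e) *\<^sub>R e) < y \<bullet> e" using eq by blast
    then show ?thesis using y(2) by simp
  qed simp
  then have "hausdorff_outer_measure (DIM('a) - 1) (frontier \<Omega> \<inter> ball p r) < \<infinity>"
    by (intro hausdorff_outer_measure_graph_finite[OF h e]) (auto intro: bounded_Int)
  then show ?thesis using r by blast
qed

text \<open>The frontier is compact, so finitely many charts cover it. Subadditivity is taken for
  the measure itself, and each piece is then bounded by its outer measure.\<close>

lemma finite_surface_measure:
  fixes \<Omega> :: "'a::euclidean_space set"
  assumes "smooth_bounded_domain \<Omega>"
  shows "finite_measure (surface_measure \<Omega>)"
proof -
  let ?M = "hausdorff_measure (DIM('a) - 1) :: 'a measure"
  have \<Omega>: "open \<Omega>" "bounded \<Omega>" "smooth_boundary \<Omega>"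
    using assms unfolding smooth_bounded_domain_def by auto
  obtain r where r: "\<And>p. p \<in> frontier \<Omega> \<Longrightarrow> r p > 0 \<and>
      hausdorff_outer_measure (DIM('a) - 1) (frontier \<Omega> \<inter> ball p (r p)) < \<infinity>"
    using frontier_locally_finite[OF \<Omega>(1,3)] by metis
  have cover: "frontier \<Omega> \<subseteq> (\<Union>p\<in>frontier \<Omega>. ball p (r p))" using r by force
  from \<Omega>(2) have "compact (frontier \<Omega>)" by (rule compact_frontier_bounded)
  then obtain D where D: "D \<subseteq> frontier \<Omega>" "finite D" "frontier \<Omega> \<subseteq> (\<Union>p\<in>D. ball p (r p))"
    by (rule compactE_image[OF _ open_ball cover])
  have fb: "frontier \<Omega> \<in> sets borel" by simp
  have "frontier \<Omega> = (\<Union>p\<in>D. frontier \<Omega> \<inter> ball p (r p))" using D(3) by blast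
  then have "emeasure ?M (frontier \<Omega>) = emeasure ?M (\<Union>p\<in>D. frontier \<Omega> \<inter> ball p (r p))" by simp
  also have "\<dots> \<le> (\<Sum>p\<in>D. emeasure ?M (frontier \<Omega> \<inter> ball p (r p)))"
    using D(2) by (intro emeasure_subadditive_finite) auto
  also have "\<dots> < \<infinity>"
  proof -
    have "emeasure ?M (frontier \<Omega> \<inter> ball p (r p)) < \<infinity>" if "p \<in> D" for p
      using le_less_trans[OF emeasure_hausdorff_measure_le] r D(1) that by blast
    then show ?thesis using D(2) by simp
  qed
  finally have "emeasure ?M (frontier \<Omega>) < \<infinity>" .
  then show ?thesis
    unfolding surface_measure_def
    by (intro finite_measureI) (simp add: emeasure_restrict_space space_restrict_space)
qed

lemma measurable_surface_measure:
  fixes f :: "'a::euclidean_space \<Rightarrow> real"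
  assumes "continuous_on (frontier \<Omega>) f"
  shows "f \<in> borel_measurable (surface_measure \<Omega>)"
proof -
  have "f \<in> borel_measurable (restrict_space borel (frontier \<Omega>))"
    by (rule borel_measurable_continuous_on_restrict[OF assms])
  moreover have "sets (surface_measure \<Omega>) = sets (restrict_space borel (frontier \<Omega>))"
    unfolding surface_measure_def by (rule sets_restrict_space_cong) simp
  ultimately show ?thesis by (simp cong: measurable_cong_sets)
qed

lemma space_surface_measure [simp]: "space (surface_measure \<Omega>) = frontier \<Omega>"
  unfolding surface_measure_def by (simp add: space_restrict_space)

subsection \<open>Sobolev functions continuous up to the boundary\<close>

lemma square_integrable_lincomb:
  fixes f g :: "'a \<Rightarrow> 'b::euclidean_space"
  assumes "square_integrable M f" "square_integrable M g"
  shows "square_integrable M (\<lambda>x. c *\<^sub>R f x + d *\<^sub>R g x)"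
proof -
  have [measurable]: "f \<in> borel_measurable M" "g \<in> borel_measurable M"
    and i: "integrable M (\<lambda>x. (norm (f x))\<^sup>2)" "integrable M (\<lambda>x. (norm (g x))\<^sup>2)"
    using assms unfolding square_integrable_def by auto
  have "integrable M (\<lambda>x. (norm (c *\<^sub>R f x + d *\<^sub>R g x))\<^sup>2)"
  proof (rule Bochner_Integration.integrable_bound)
    show "integrable M (\<lambda>x. 2 * c\<^sup>2 * (norm (f x))\<^sup>2 + 2 * d\<^sup>2 * (norm (g x))\<^sup>2)"
      using i by (intro Bochner_Integration.integrable_add integrable_mult_right)
    show "(\<lambda>x. (norm (c *\<^sub>R f x + d *\<^sub>R g x))\<^sup>2) \<in> borel_measurable M" by measurable
    show "AE x in M. norm ((norm (c *\<^sub>R f x + d *\<^sub>R g x))\<^sup>2)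
        \<le> norm (2 * c\<^sup>2 * (norm (f x))\<^sup>2 + 2 * d\<^sup>2 * (norm (g x))\<^sup>2)"
    proof (rule AE_I2)
      fix x
      have "(norm (c *\<^sub>R f x + d *\<^sub>R g x))\<^sup>2 \<le> (norm (c *\<^sub>R f x) + norm (d *\<^sub>R g x))\<^sup>2"
        by (intro power_mono norm_triangle_ineq) simp
      also have "\<dots> \<le> 2 * (norm (c *\<^sub>R f x))\<^sup>2 + 2 * (norm (d *\<^sub>R g x))\<^sup>2"
        using zero_le_power2[of "norm (c *\<^sub>R f x) - norm (d *\<^sub>R g x)"]
        by (simp only: power2_sum power2_diff)
      also have "\<dots> = 2 * c\<^sup>2 * (norm (f x))\<^sup>2 + 2 * d\<^sup>2 * (norm (g x))\<^sup>2"
        by (simp add: power_mult_distrib)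
      finally show "norm ((norm (c *\<^sub>R f x + d *\<^sub>R g x))\<^sup>2)
        \<le> norm (2 * c\<^sup>2 * (norm (f x))\<^sup>2 + 2 * d\<^sup>2 * (norm (g x))\<^sup>2)" by simp
    qed
  qed
  then show ?thesis unfolding square_integrable_def by simp
qed

lemma integrable_inner_square_integrable:
  assumes "square_integrable M f" "square_integrable M g"
  shows "integrable M (\<lambda>x. f x \<bullet> g x)"
proof (rule Bochner_Integration.integrable_bound)
  have [measurable]: "f \<in> borel_measurable M" "g \<in> borel_measurable M"
    and i: "integrable M (\<lambda>x. (norm (f x))\<^sup>2)" "integrable M (\<lambda>x. (norm (g x))\<^sup>2)"
    using assms unfolding square_integrable_def by auto
  show "integrable M (\<lambda>x. (norm (f x))\<^sup>2 + (norm (g x))\<^sup>2)" using i by simp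
  show "(\<lambda>x. f x \<bullet> g x) \<in> borel_measurable M" by measurable
  show "AE x in M. norm (f x \<bullet> g x) \<le> norm ((norm (f x))\<^sup>2 + (norm (g x))\<^sup>2)"
  proof (rule AE_I2)
    fix x
    have "2 * (norm (f x) * norm (g x)) \<le> (norm (f x))\<^sup>2 + (norm (g x))\<^sup>2"
      using zero_le_power2[of "norm (f x) - norm (g x)"] by (simp add: power2_diff)
    moreover have "0 \<le> norm (f x) * norm (g x)" by simp
    ultimately show "norm (f x \<bullet> g x) \<le> norm ((norm (f x))\<^sup>2 + (norm (g x))\<^sup>2)"
      using Cauchy_Schwarz_ineq2[of "f x" "g x"] by simp
  qed
qed

lemma H1_gradient_lincomb:
  fixes \<Omega> :: "'a::euclidean_space set"
  assumes "open \<Omega>" "bounded \<Omega>" "H1_gradient \<Omega> u G" "H1_gradient \<Omega> v H"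
  shows "H1_gradient \<Omega> (\<lambda>x. c * u x + d * v x) (\<lambda>x. c *\<^sub>R G x + d *\<^sub>R H x)"
proof -
  let ?L = "lebesgue_on \<Omega>"
  have "(LINT x|?L. (c * u x + d * v x) * frechet_derivative \<phi> (at x) i) =
        - (LINT x|?L. ((c *\<^sub>R G x + d *\<^sub>R H x) \<bullet> i) * \<phi> x)"
    if tf: "test_function \<Omega> \<phi>" and i: "i \<in> Basis" for \<phi> i
  proof -
    have sm: "smooth \<phi>" and cK: "compact (closure {x. \<phi> x \<noteq> 0})"
      using tf unfolding test_function_def by auto
    have "\<exists>B>0. \<forall>x. \<bar>\<phi> x\<bar> \<le> B"
      by (rule bounded_compact_support[OF smooth_continuous[OF sm] cK]) (rule test_function_zero)
    then obtain B where B: "\<And>x. \<bar>\<phi> x\<bar> \<le> B" by auto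
    note cD = smooth_continuous[OF smooth_derivative[OF sm, of i]]
    have "\<exists>B>0. \<forall>x. \<bar>frechet_derivative \<phi> (at x) i\<bar> \<le> B"
      by (rule bounded_compact_support[OF cD cK]) (rule frechet_derivative_zero_off_support)
    then obtain C where C: "\<And>x. \<bar>frechet_derivative \<phi> (at x) i\<bar> \<le> C" by auto
    have 1: "integrable ?L (\<lambda>x. w x * frechet_derivative \<phi> (at x) i)" if "H1_gradient \<Omega> w K" for w K
      by (rule integrable_mult_bounded_continuous[OF assms(1) H1_gradient_imp_integrable(1)[OF assms(1,2) that]
            continuous_on_subset[OF cD] C]) simp
    have 2: "integrable ?L (\<lambda>x. (K x \<bullet> i) * \<phi> x)" if "H1_gradient \<Omega> w K" for w K
      by (rule integrable_mult_bounded_continuous[OF assms(1) H1_gradient_imp_integrable(2)[OF assms(1,2) that]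
            continuous_on_subset[OF smooth_continuous[OF sm]] B]) simp
    have "(LINT x|?L. (c * u x + d * v x) * frechet_derivative \<phi> (at x) i)
        = (LINT x|?L. c * (u x * frechet_derivative \<phi> (at x) i) + d * (v x * frechet_derivative \<phi> (at x) i))"
      by (rule Bochner_Integration.integral_cong) (simp_all add: algebra_simps)
    also have "\<dots> = c * (LINT x|?L. u x * frechet_derivative \<phi> (at x) i) + d * (LINT x|?L. v x * frechet_derivative \<phi> (at x) i)"
      using 1[OF assms(3)] 1[OF assms(4)] by simp
    also have "(LINT x|?L. u x * frechet_derivative \<phi> (at x) i) = - (LINT x|?L. (G x \<bullet> i) * \<phi> x)"
      using assms(3) tf i unfolding H1_gradient_def by blast
    also have "(LINT x|?L. v x * frechet_derivative \<phi> (at x) i) = - (LINT x|?L. (H x \<bullet> i) * \<phi> x)"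
      using assms(4) tf i unfolding H1_gradient_def by blast
    also have "c * - (LINT x|?L. (G x \<bullet> i) * \<phi> x) + d * - (LINT x|?L. (H x \<bullet> i) * \<phi> x)
        = - (LINT x|?L. c * ((G x \<bullet> i) * \<phi> x) + d * ((H x \<bullet> i) * \<phi> x))"
      using 2[OF assms(3)] 2[OF assms(4)] by simp
    also have "\<dots> = - (LINT x|?L. ((c *\<^sub>R G x + d *\<^sub>R H x) \<bullet> i) * \<phi> x)"
      by (intro arg_cong[where f = uminus] Bochner_Integration.integral_cong) (simp_all add: algebra_simps)
    finally show ?thesis .
  qed
  moreover have "square_integrable ?L (\<lambda>x. c * u x + d * v x)"
    using square_integrable_lincomb[of ?L u v c d] assms(3,4) unfolding H1_gradient_def by simp
  moreover have "square_integrable ?L (\<lambda>x. c *\<^sub>R G x + d *\<^sub>R H x)"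
    using square_integrable_lincomb[of ?L G H c d] assms(3,4) unfolding H1_gradient_def by simp
  ultimately show ?thesis unfolding H1_gradient_def by blast
qed

text \<open>By polarisation, the product rule reduces to the chain rule for squares.\<close>

lemma H1_gradient_mult_zero_gradient:
  fixes \<Omega> :: "'a::euclidean_space set"
  assumes "open \<Omega>" "bounded \<Omega>" and c: "continuous_on (closure \<Omega>) \<psi>" "continuous_on (closure \<Omega>) u"
    and H: "H1_gradient \<Omega> \<psi> (\<lambda>_. 0)" "H1_gradient \<Omega> u G"
  shows "H1_gradient \<Omega> (\<lambda>x. \<psi> x * u x) (\<lambda>x. \<psi> x *\<^sub>R G x)"
proof -
  have sq: "H1_gradient \<Omega> (\<lambda>x. (w x)\<^sup>2) (\<lambda>x. (2 * w x) *\<^sub>R K x)"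
    if "continuous_on (closure \<Omega>) w" "H1_gradient \<Omega> w K" for w K
    by (rule H1_gradient_chain_rule[OF assms(1,2) that]) (auto intro!: derivative_eq_intros continuous_intros)
  have s: "H1_gradient \<Omega> (\<lambda>x. 1 * \<psi> x + 1 * u x) (\<lambda>x. 1 *\<^sub>R 0 + 1 *\<^sub>R G x)"
    by (rule H1_gradient_lincomb[OF assms(1,2) H])
  have "continuous_on (closure \<Omega>) (\<lambda>x. 1 * \<psi> x + 1 * u x)" using c by (intro continuous_intros)
  note 1 = sq[OF this s]
  note 2 = H1_gradient_lincomb[OF assms(1,2) sq[OF c(1) H(1)] sq[OF c(2) H(2)], of 1 1]
  \<comment> \<open>\<psi> u = (1/2) (\<psi> + u)^2 - (1/2) (\<psi>^2 + u^2). As \<psi> has gradient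
    0, the gradients combine to (\<psi> + u) G - u G = \<psi> G.\<close>
  note 3 = H1_gradient_lincomb[OF assms(1,2) 1 2, of "1/2" "-1/2"]
  moreover have "(\<lambda>x. 1/2 * (1 * \<psi> x + 1 * u x)\<^sup>2 + -1/2 * (1 * (\<psi> x)\<^sup>2 + 1 * (u x)\<^sup>2)) = (\<lambda>x. \<psi> x * u x)"
    by (auto simp: power2_eq_square algebra_simps)
  moreover have "(\<lambda>x. (1/2) *\<^sub>R (2 * (1 * \<psi> x + 1 * u x)) *\<^sub>R (1 *\<^sub>R 0 + 1 *\<^sub>R G x) +
      (-1/2) *\<^sub>R (1 *\<^sub>R (2 * \<psi> x) *\<^sub>R 0 + 1 *\<^sub>R (2 * u x) *\<^sub>R G x)) = (\<lambda>x. \<psi> x *\<^sub>R G x)"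
    by (auto simp: algebra_simps)
  ultimately show ?thesis by simp
qed

text \<open>Null sets do not affect the defining integrals. This turns a gradient that vanishes
  almost everywhere into the literal zero function expected by the product rule.\<close>

lemma H1_gradient_AE_zero:
  assumes "H1_gradient \<Omega> w G" "AE x in lebesgue_on \<Omega>. G x = 0"
  shows "H1_gradient \<Omega> w (\<lambda>_. 0)"
proof -
  have "(LINT x|lebesgue_on \<Omega>. (G x \<bullet> i) * \<phi> x) = 0" for i \<phi>
    by (rule integral_eq_zero_AE) (use assms(2) in \<open>auto elim!: eventually_mono\<close>)
  then show ?thesis using assms(1)
    unfolding H1_gradient_def square_integrable_def by simp
qed

text \<open>The constant sequence \<psi> is its own approximation. The one nontrivial requirement is
  square integrability on the boundary, which follows from boundedness of \<psi> and finiteness of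
  the surface measure.\<close>

lemma has_trace_continuous:
  fixes \<Omega> :: "'a::euclidean_space set"
  assumes dom: "smooth_bounded_domain \<Omega>" and c: "continuous_on (closure \<Omega>) \<psi>" and H: "H1_gradient \<Omega> \<psi> G"
  shows "has_trace \<Omega> \<psi> \<psi>"
proof -
  have b: "bounded \<Omega>" using dom unfolding smooth_bounded_domain_def by blast
  have fr: "frontier \<Omega> \<subseteq> closure \<Omega>" by (auto simp: frontier_def)
  have const: "L2_converges M (\<lambda>_. f) f" if "square_integrable M f" for M :: "'a measure" and f :: "'a \<Rightarrow> 'b::euclidean_space"
    unfolding L2_converges_def using that by simp
  obtain C where C: "\<And>x. x \<in> closure \<Omega> \<Longrightarrow> \<bar>\<psi> x\<bar> \<le> C"
    using bounded_on_closure[OF b c] by metis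
  have "square_integrable (surface_measure \<Omega>) \<psi>"
    by (rule square_integrable_bounded[OF finite_surface_measure[OF dom]
          measurable_surface_measure[OF continuous_on_subset[OF c fr]], of C])
       (use C fr in auto)
  moreover have "square_integrable (lebesgue_on \<Omega>) \<psi>" "square_integrable (lebesgue_on \<Omega>) G"
    using H unfolding H1_gradient_def by blast+
  ultimately have "L2_converges (lebesgue_on \<Omega>) (\<lambda>_. \<psi>) \<psi>" "L2_converges (lebesgue_on \<Omega>) (\<lambda>_. G) G"
    "L2_converges (surface_measure \<Omega>) (\<lambda>_. \<psi>) \<psi>" using const by blast+
  then show ?thesis unfolding has_trace_def using H c
    by (intro exI[of _ G] conjI exI[of _ "\<lambda>_. \<psi>"] exI[of _ "\<lambda>_. G"] allI)
qed

text \<open>The integrand vanishes almost everywhere, so the set where it is nonzero is both open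
  and negligible, hence empty.\<close>

lemma continuous_nonneg_integral_zero:
  fixes \<Omega> :: "'a::euclidean_space set"
  assumes \<Omega>: "open \<Omega>" "bounded \<Omega>" and c: "continuous_on (closure \<Omega>) f"
    and nn: "\<And>x. x \<in> \<Omega> \<Longrightarrow> f x \<ge> 0" and 0: "(LINT x|lebesgue_on \<Omega>. f x) = 0"
    and x: "x \<in> \<Omega>"
  shows "f x = (0::real)"
proof (rule ccontr)
  assume "f x \<noteq> 0"
  let ?N = "{x \<in> \<Omega>. f x \<noteq> 0}"
  have c\<Omega>: "continuous_on \<Omega> f" by (rule continuous_on_subset[OF c closure_subset])
  have "integrable (lebesgue_on \<Omega>) f"
    by (intro square_integrable_imp_integrable finite_measure_lebesgue_on_bounded_open
        square_integrable_continuous_closure \<Omega> c)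
  then have "AE x in lebesgue_on \<Omega>. f x = 0"
    using 0 nn by (subst (asm) integral_nonneg_eq_0_iff_AE) auto
  then have ae: "AE x in lebesgue. x \<in> \<Omega> \<longrightarrow> f x = 0"
    using \<Omega>(1) by (subst (asm) AE_restrict_space_iff) auto
  have "open (\<Omega> \<inter> f -` (- {0}))"
    by (rule continuous_open_preimage[OF c\<Omega> \<Omega>(1)]) (rule open_Compl, simp)
  moreover have eq: "\<Omega> \<inter> f -` (- {0}) = ?N" by auto
  ultimately have op: "open ?N" by simp
  have "?N \<in> null_sets lebesgue"
    using ae op AE_iff_null[of lebesgue "\<lambda>x. x \<in> \<Omega> \<longrightarrow> f x = 0"] by simp
  then have "negligible ?N" by (simp add: negligible_iff_null_sets)
  then show False using open_not_negligible[OF op] x \<open>f x \<noteq> 0\<close> by blast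
qed

text \<open>Away from 0 the function agrees locally with 0 or with t^2; at 0 the difference quotient
  is bounded by the absolute value of the increment.\<close>

lemma has_real_derivative_positive_part_square:
  "((\<lambda>t. (max 0 t)\<^sup>2) has_real_derivative 2 * max 0 t) (at t)"
proof (rule linorder_cases[of t 0])
  assume "t < 0"
  have "((\<lambda>_. 0) has_real_derivative 2 * max 0 t) (at t)"
    using \<open>t < 0\<close> by (simp add: max_def)
  then show ?thesis
    by (rule has_field_derivative_transform_within_open[where S = "{..<0}"]) (use \<open>t < 0\<close> in auto)
next
  assume "t > 0"
  have "((\<lambda>s. s\<^sup>2) has_real_derivative 2 * max 0 t) (at t)"
    using \<open>t > 0\<close> by (auto intro!: derivative_eq_intros simp: max_def)
  then show ?thesis
    by (rule has_field_derivative_transform_within_open[where S = "{0<..}"]) (use \<open>t > 0\<close> in auto)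
next
  assume t: "t = 0"
  have "((\<lambda>h. (max 0 h)\<^sup>2 / h) \<longlongrightarrow> 0) (at (0::real))"
  proof (rule Lim_null_comparison)
    show "\<forall>\<^sub>F h in at 0. norm ((max 0 h)\<^sup>2 / h) \<le> \<bar>h::real\<bar>"
      by (auto simp: max_def power2_eq_square intro!: always_eventually)
    show "((\<lambda>h. \<bar>h::real\<bar>) \<longlongrightarrow> 0) (at 0)" by (auto intro!: tendsto_eq_intros)
  qed
  then show ?thesis unfolding t DERIV_def by simp
qed

subsection \<open>Comparison of positive solutions\<close>

text \<open>Every test function in the sequel is continuous up to the boundary, so it can stand for
  its own trace and \<tau> disappears from the equations.\<close>

lemma weak_solution_test:
  fixes \<Omega> :: "'a::euclidean_space set"
  assumes "smooth_bounded_domain \<Omega>" "weak_solution \<Omega> a b \<alpha> \<beta> \<gamma> u\<^sub>1 u\<^sub>2"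
  obtains G\<^sub>1 G\<^sub>2 where "H1_gradient \<Omega> u\<^sub>1 G\<^sub>1" "H1_gradient \<Omega> u\<^sub>2 G\<^sub>2"
    "\<And>\<psi> G. H1_gradient \<Omega> \<psi> G \<Longrightarrow> continuous_on (closure \<Omega>) \<psi> \<Longrightarrow>
       (LINT x|lebesgue_on \<Omega>. G\<^sub>1 x \<bullet> G x) + \<alpha> * (LINT x|surface_measure \<Omega>. u\<^sub>1 x * \<psi> x)
           = (LINT x|lebesgue_on \<Omega>. (u\<^sub>1 x * u\<^sub>2 x - b * u\<^sub>1 x) * \<psi> x)"
    "\<And>\<psi> G. H1_gradient \<Omega> \<psi> G \<Longrightarrow> continuous_on (closure \<Omega>) \<psi> \<Longrightarrow>
       (LINT x|lebesgue_on \<Omega>. G\<^sub>2 x \<bullet> G x)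
             + \<beta> * (LINT x|surface_measure \<Omega>. \<bar>u\<^sub>2 x\<bar> powr (\<gamma> - 2) * u\<^sub>2 x * \<psi> x)
           = a * (LINT x|lebesgue_on \<Omega>. u\<^sub>1 x * \<psi> x)"
proof -
  obtain G\<^sub>1 G\<^sub>2 where G: "H1_gradient \<Omega> u\<^sub>1 G\<^sub>1" "H1_gradient \<Omega> u\<^sub>2 G\<^sub>2"
    and test: "\<forall>\<psi> G \<tau>. H1_gradient \<Omega> \<psi> G \<and> has_trace \<Omega> \<psi> \<tau> \<longrightarrow>
       (LINT x|lebesgue_on \<Omega>. G\<^sub>1 x \<bullet> G x) + \<alpha> * (LINT x|surface_measure \<Omega>. u\<^sub>1 x * \<tau> x)
           = (LINT x|lebesgue_on \<Omega>. (u\<^sub>1 x * u\<^sub>2 x - b * u\<^sub>1 x) * \<psi> x) \<and>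
       (LINT x|lebesgue_on \<Omega>. G\<^sub>2 x \<bullet> G x)
             + \<beta> * (LINT x|surface_measure \<Omega>. \<bar>u\<^sub>2 x\<bar> powr (\<gamma> - 2) * u\<^sub>2 x * \<tau> x)
           = a * (LINT x|lebesgue_on \<Omega>. u\<^sub>1 x * \<psi> x)"
    using assms(2) unfolding weak_solution_def by (elim conjE exE)
  note test_continuous = test[rule_format, OF conjI, OF _ has_trace_continuous[OF assms(1)]]
  show ?thesis
    by (rule that[OF G])
       (rule conjunct1[OF test_continuous] conjunct2[OF test_continuous]; assumption)+
qed

lemma integrable_continuous_closure:
  fixes f :: "'a::euclidean_space \<Rightarrow> real"
  assumes "open \<Omega>" "bounded \<Omega>" "continuous_on (closure \<Omega>) f"
  shows "integrable (lebesgue_on \<Omega>) f"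
  by (intro square_integrable_imp_integrable finite_measure_lebesgue_on_bounded_open
      square_integrable_continuous_closure assms)

lemma eq_on_closure:
  fixes f g :: "'a::euclidean_space \<Rightarrow> real"
  assumes "continuous_on (closure \<Omega>) f" "continuous_on (closure \<Omega>) g"
    and "\<And>x. x \<in> \<Omega> \<Longrightarrow> f x = g x" and "x \<in> closure \<Omega>"
  shows "f x = g x"
  using continuous_constant_on_closure[OF continuous_on_diff[OF assms(1,2)], of 0 x] assms(3,4) by simp

lemma ordered_second_component:
  fixes \<Omega> :: "'a::euclidean_space set"
  assumes dom: "smooth_bounded_domain \<Omega>" and a: "a > 0"
    and u: "positive_solution \<Omega> a b \<alpha> \<beta> \<gamma> u\<^sub>1 u\<^sub>2"
    and v: "positive_solution \<Omega> a b \<alpha> \<beta> \<gamma> v\<^sub>1 v\<^sub>2"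
    and le: "\<And>x. x \<in> \<Omega> \<Longrightarrow> u\<^sub>2 x \<le> v\<^sub>2 x"
  shows "(\<forall>x\<in>closure \<Omega>. u\<^sub>1 x = v\<^sub>1 x) \<and> (\<forall>x\<in>closure \<Omega>. u\<^sub>2 x = v\<^sub>2 x)"
proof -
  let ?L = "lebesgue_on \<Omega>"
  have \<Omega>: "open \<Omega>" "bounded \<Omega>" using dom unfolding smooth_bounded_domain_def by auto
  note icc = integrable_continuous_closure[OF \<Omega>]
  have c: "continuous_on (closure \<Omega>) u\<^sub>1" "continuous_on (closure \<Omega>) u\<^sub>2"
      "continuous_on (closure \<Omega>) v\<^sub>1" "continuous_on (closure \<Omega>) v\<^sub>2"
    and wu: "weak_solution \<Omega> a b \<alpha> \<beta> \<gamma> u\<^sub>1 u\<^sub>2" and wv: "weak_solution \<Omega> a b \<alpha> \<beta> \<gamma> v\<^sub>1 v\<^sub>2"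
    and pos: "\<And>x. x \<in> \<Omega> \<Longrightarrow> u\<^sub>1 x > 0" "\<And>x. x \<in> \<Omega> \<Longrightarrow> v\<^sub>1 x > 0"
    using u v unfolding positive_solution_def weak_solution_def by auto
  obtain G\<^sub>1 G\<^sub>2 where G: "H1_gradient \<Omega> u\<^sub>1 G\<^sub>1" "H1_gradient \<Omega> u\<^sub>2 G\<^sub>2"
    and Gt: "\<And>\<psi> G. H1_gradient \<Omega> \<psi> G \<Longrightarrow> continuous_on (closure \<Omega>) \<psi> \<Longrightarrow>
       (LINT x|?L. G\<^sub>1 x \<bullet> G x) + \<alpha> * (LINT x|surface_measure \<Omega>. u\<^sub>1 x * \<psi> x)
           = (LINT x|?L. (u\<^sub>1 x * u\<^sub>2 x - b * u\<^sub>1 x) * \<psi> x)"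
    "\<And>\<psi> G. H1_gradient \<Omega> \<psi> G \<Longrightarrow> continuous_on (closure \<Omega>) \<psi> \<Longrightarrow>
       (LINT x|?L. G\<^sub>2 x \<bullet> G x) + \<beta> * (LINT x|surface_measure \<Omega>. \<bar>u\<^sub>2 x\<bar> powr (\<gamma> - 2) * u\<^sub>2 x * \<psi> x)
           = a * (LINT x|?L. u\<^sub>1 x * \<psi> x)"
    by (rule weak_solution_test[OF dom wu]; rule that; assumption)
  obtain H\<^sub>1 H\<^sub>2 where H: "H1_gradient \<Omega> v\<^sub>1 H\<^sub>1" "H1_gradient \<Omega> v\<^sub>2 H\<^sub>2"
    and Ht: "\<And>\<psi> G. H1_gradient \<Omega> \<psi> G \<Longrightarrow> continuous_on (closure \<Omega>) \<psi> \<Longrightarrow>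
       (LINT x|?L. H\<^sub>1 x \<bullet> G x) + \<alpha> * (LINT x|surface_measure \<Omega>. v\<^sub>1 x * \<psi> x)
           = (LINT x|?L. (v\<^sub>1 x * v\<^sub>2 x - b * v\<^sub>1 x) * \<psi> x)"
    "\<And>\<psi> G. H1_gradient \<Omega> \<psi> G \<Longrightarrow> continuous_on (closure \<Omega>) \<psi> \<Longrightarrow>
       (LINT x|?L. H\<^sub>2 x \<bullet> G x) + \<beta> * (LINT x|surface_measure \<Omega>. \<bar>v\<^sub>2 x\<bar> powr (\<gamma> - 2) * v\<^sub>2 x * \<psi> x)
           = a * (LINT x|?L. v\<^sub>1 x * \<psi> x)"
    by (rule weak_solution_test[OF dom wv]; rule that; assumption)
  \<comment> \<open>The Dirichlet term and the boundary term with \<alpha> are symmetric in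
    \<open>u\<^sub>1\<close> and \<open>v\<^sub>1\<close>, so only the right-hand sides
    survive.\<close>
  have "(LINT x|?L. (u\<^sub>1 x * u\<^sub>2 x - b * u\<^sub>1 x) * v\<^sub>1 x) = (LINT x|?L. (v\<^sub>1 x * v\<^sub>2 x - b * v\<^sub>1 x) * u\<^sub>1 x)"
    using Gt(1)[OF H(1) c(3)] Ht(1)[OF G(1) c(1)] by (simp add: inner_commute mult.commute)
  moreover have "(LINT x|?L. (v\<^sub>1 x * v\<^sub>2 x - b * v\<^sub>1 x) * u\<^sub>1 x - (u\<^sub>1 x * u\<^sub>2 x - b * u\<^sub>1 x) * v\<^sub>1 x)
    = (LINT x|?L. (v\<^sub>1 x * v\<^sub>2 x - b * v\<^sub>1 x) * u\<^sub>1 x) - (LINT x|?L. (u\<^sub>1 x * u\<^sub>2 x - b * u\<^sub>1 x) * v\<^sub>1 x)"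
    by (intro Bochner_Integration.integral_diff icc continuous_intros c)
  ultimately have "(LINT x|?L. (v\<^sub>1 x * v\<^sub>2 x - b * v\<^sub>1 x) * u\<^sub>1 x - (u\<^sub>1 x * u\<^sub>2 x - b * u\<^sub>1 x) * v\<^sub>1 x) = 0" by simp
  then have "(LINT x|?L. u\<^sub>1 x * v\<^sub>1 x * (v\<^sub>2 x - u\<^sub>2 x)) = 0"
    by (simp add: algebra_simps)
  then have "u\<^sub>1 x * v\<^sub>1 x * (v\<^sub>2 x - u\<^sub>2 x) = 0" if "x \<in> \<Omega>" for x
    by (rule continuous_nonneg_integral_zero[OF \<Omega>, rotated 2])
       (use that pos le in \<open>auto intro!: continuous_intros c mult_nonneg_nonneg simp: less_imp_le\<close>)
  then have "u\<^sub>2 x = v\<^sub>2 x" if "x \<in> \<Omega>" for x using pos that by force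
  then have eq2: "u\<^sub>2 x = v\<^sub>2 x" if "x \<in> closure \<Omega>" for x
    using eq_on_closure[OF c(2,4)] that by blast
  then have bd: "u\<^sub>2 x = v\<^sub>2 x" if "x \<in> frontier \<Omega>" for x using that by (simp add: frontier_def)
  have eqL: "u\<^sub>2 x = v\<^sub>2 x" if "x \<in> \<Omega>" for x using eq2 that closure_subset[of \<Omega>] by blast
  have bdint: "(LINT x|surface_measure \<Omega>. \<bar>u\<^sub>2 x\<bar> powr (\<gamma> - 2) * u\<^sub>2 x * \<psi> x)
      = (LINT x|surface_measure \<Omega>. \<bar>v\<^sub>2 x\<bar> powr (\<gamma> - 2) * v\<^sub>2 x * \<psi> x)" for \<psi>
    by (rule Bochner_Integration.integral_cong) (simp_all add: bd)
  have sq: "square_integrable ?L G\<^sub>2" "square_integrable ?L H\<^sub>2"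
    using G(2) H(2) unfolding H1_gradient_def by blast+
  have bdint2: "(LINT x|surface_measure \<Omega>. f x * u\<^sub>2 x) = (LINT x|surface_measure \<Omega>. f x * v\<^sub>2 x)" for f
    by (rule Bochner_Integration.integral_cong) (simp_all add: bd)
  have Lint: "(LINT x|?L. f x * u\<^sub>2 x) = (LINT x|?L. f x * v\<^sub>2 x)" for f
    by (rule Bochner_Integration.integral_cong) (simp_all add: eqL)
  \<comment> \<open>That the weak gradients of \<open>u\<^sub>2\<close> and \<open>v\<^sub>2\<close>
    agree is extracted from the equations: the test functions \<open>u\<^sub>2\<close> and
    \<open>v\<^sub>2\<close> coincide on the closure, so in each second equation everything but the
    Dirichlet term is the same for both. With \<open>e2\<close> this makes the integral of the
    squared difference vanish.\<close>
  have e1: "(LINT x|?L. G\<^sub>2 x \<bullet> G\<^sub>2 x) = (LINT x|?L. G\<^sub>2 x \<bullet> H\<^sub>2 x)"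
    using Gt(2)[OF G(2) c(2)] Gt(2)[OF H(2) c(4)] unfolding bdint2 Lint by linarith
  have e2: "(LINT x|?L. H\<^sub>2 x \<bullet> G\<^sub>2 x) = (LINT x|?L. H\<^sub>2 x \<bullet> H\<^sub>2 x)"
    using Ht(2)[OF G(2) c(2)] Ht(2)[OF H(2) c(4)] unfolding bdint2 Lint by linarith
  have "square_integrable ?L (\<lambda>x. G\<^sub>2 x - H\<^sub>2 x)"
    using square_integrable_lincomb[OF sq, of 1 "-1"] by simp
  then have id: "integrable ?L (\<lambda>x. (G\<^sub>2 x - H\<^sub>2 x) \<bullet> (G\<^sub>2 x - H\<^sub>2 x))"
    using integrable_inner_square_integrable by blast
  have "(LINT x|?L. (G\<^sub>2 x - H\<^sub>2 x) \<bullet> (G\<^sub>2 x - H\<^sub>2 x))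
      = (LINT x|?L. (G\<^sub>2 x \<bullet> G\<^sub>2 x - G\<^sub>2 x \<bullet> H\<^sub>2 x) - (H\<^sub>2 x \<bullet> G\<^sub>2 x - H\<^sub>2 x \<bullet> H\<^sub>2 x))"
    by (rule Bochner_Integration.integral_cong) (simp_all add: inner_diff_left inner_diff_right)
  also have "\<dots> = 0"
    using e1 e2 sq by (simp add: integrable_inner_square_integrable)
  finally have "AE x in ?L. (G\<^sub>2 x - H\<^sub>2 x) \<bullet> (G\<^sub>2 x - H\<^sub>2 x) = 0"
    using id by (subst (asm) integral_nonneg_eq_0_iff_AE) auto
  then have ae: "AE x in ?L. G\<^sub>2 x = H\<^sub>2 x" by simp
  define \<psi> where "\<psi> x = u\<^sub>1 x - v\<^sub>1 x" for x
  have c\<psi>: "continuous_on (closure \<Omega>) \<psi>" unfolding \<psi>_def by (intro continuous_intros c)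
  have h\<psi>: "H1_gradient \<Omega> \<psi> (\<lambda>x. 1 *\<^sub>R G\<^sub>1 x + (-1) *\<^sub>R H\<^sub>1 x)"
    using H1_gradient_lincomb[OF \<Omega> G(1) H(1), of 1 "-1"] unfolding \<psi>_def by simp
  have mK: "(\<lambda>x. 1 *\<^sub>R G\<^sub>1 x + (-1) *\<^sub>R H\<^sub>1 x) \<in> borel_measurable ?L"
    using h\<psi> unfolding H1_gradient_def square_integrable_def by blast
  have mG: "G\<^sub>2 \<in> borel_measurable ?L" "H\<^sub>2 \<in> borel_measurable ?L"
    using sq unfolding square_integrable_def by auto
  have eqG: "(LINT x|?L. G\<^sub>2 x \<bullet> (1 *\<^sub>R G\<^sub>1 x + (-1) *\<^sub>R H\<^sub>1 x)) = (LINT x|?L. H\<^sub>2 x \<bullet> (1 *\<^sub>R G\<^sub>1 x + (-1) *\<^sub>R H\<^sub>1 x))"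
    by (intro integral_cong_AE borel_measurable_inner mK mG) (use ae in auto)
  \<comment> \<open>The left sides of both second equations now agree for every admissible test
    function. The choice of \<psi> makes the difference of the right sides \<open>a\<close> times
    the integral of the square of \<open>u\<^sub>1 - v\<^sub>1\<close>.\<close>
  have "a * (LINT x|?L. u\<^sub>1 x * \<psi> x) = a * (LINT x|?L. v\<^sub>1 x * \<psi> x)"
    using Gt(2)[OF h\<psi> c\<psi>, unfolded eqG bdint[of \<psi>]] Ht(2)[OF h\<psi> c\<psi>] by (rule trans[OF sym])
  then have "(LINT x|?L. u\<^sub>1 x * \<psi> x) - (LINT x|?L. v\<^sub>1 x * \<psi> x) = 0" using a by simp
  then have "(LINT x|?L. u\<^sub>1 x * \<psi> x - v\<^sub>1 x * \<psi> x) = 0"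
    by (subst Bochner_Integration.integral_diff) (auto intro!: icc continuous_intros c c\<psi>)
  then have "u\<^sub>1 x * \<psi> x - v\<^sub>1 x * \<psi> x = 0" if "x \<in> \<Omega>" for x
    by (rule continuous_nonneg_integral_zero[OF \<Omega>, rotated 2])
       (use that in \<open>auto intro!: continuous_intros c c\<psi> simp: \<psi>_def simp flip: left_diff_distrib\<close>)
  then have "u\<^sub>1 x = v\<^sub>1 x" if "x \<in> \<Omega>" for x
    using that unfolding \<psi>_def by (force simp flip: left_diff_distrib)
  then have "u\<^sub>1 x = v\<^sub>1 x" if "x \<in> closure \<Omega>" for x
    using eq_on_closure[OF c(1,3)] that by blast
  then show ?thesis using eq2 by blast
qed

lemma first_ordered_imp_second_ordered:
  fixes \<Omega> :: "'a::euclidean_space set"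
  assumes dom: "smooth_bounded_domain \<Omega>" and a: "a > 0" and \<beta>: "\<beta> > 0" and \<gamma>: "\<gamma> \<ge> 2"
    and u: "positive_solution \<Omega> a b \<alpha> \<beta> \<gamma> u\<^sub>1 u\<^sub>2"
    and v: "positive_solution \<Omega> a b \<alpha> \<beta> \<gamma> v\<^sub>1 v\<^sub>2"
    and le: "\<And>x. x \<in> \<Omega> \<Longrightarrow> u\<^sub>1 x \<le> v\<^sub>1 x" and x: "x \<in> \<Omega>"
  shows "u\<^sub>2 x \<le> v\<^sub>2 x"
proof -
  let ?L = "lebesgue_on \<Omega>" and ?S = "surface_measure \<Omega>"
  have \<Omega>: "open \<Omega>" "bounded \<Omega>" using dom unfolding smooth_bounded_domain_def by auto
  note icc = integrable_continuous_closure[OF \<Omega>]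
  have c: "continuous_on (closure \<Omega>) u\<^sub>1" "continuous_on (closure \<Omega>) u\<^sub>2"
      "continuous_on (closure \<Omega>) v\<^sub>1" "continuous_on (closure \<Omega>) v\<^sub>2"
    and wu: "weak_solution \<Omega> a b \<alpha> \<beta> \<gamma> u\<^sub>1 u\<^sub>2" and wv: "weak_solution \<Omega> a b \<alpha> \<beta> \<gamma> v\<^sub>1 v\<^sub>2"
    and pos: "\<And>x. x \<in> \<Omega> \<Longrightarrow> u\<^sub>1 x > 0" "\<And>x. x \<in> \<Omega> \<Longrightarrow> v\<^sub>1 x > 0"
      "\<And>x. x \<in> \<Omega> \<Longrightarrow> u\<^sub>2 x > 0" "\<And>x. x \<in> \<Omega> \<Longrightarrow> v\<^sub>2 x > 0"
    using u v unfolding positive_solution_def weak_solution_def by auto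
  obtain G\<^sub>1 G\<^sub>2 where G: "H1_gradient \<Omega> u\<^sub>1 G\<^sub>1" "H1_gradient \<Omega> u\<^sub>2 G\<^sub>2"
    and Gt: "\<And>\<psi> G. H1_gradient \<Omega> \<psi> G \<Longrightarrow> continuous_on (closure \<Omega>) \<psi> \<Longrightarrow>
       (LINT x|?L. G\<^sub>1 x \<bullet> G x) + \<alpha> * (LINT x|surface_measure \<Omega>. u\<^sub>1 x * \<psi> x)
           = (LINT x|?L. (u\<^sub>1 x * u\<^sub>2 x - b * u\<^sub>1 x) * \<psi> x)"
    "\<And>\<psi> G. H1_gradient \<Omega> \<psi> G \<Longrightarrow> continuous_on (closure \<Omega>) \<psi> \<Longrightarrow>
       (LINT x|?L. G\<^sub>2 x \<bullet> G x) + \<beta> * (LINT x|surface_measure \<Omega>. \<bar>u\<^sub>2 x\<bar> powr (\<gamma> - 2) * u\<^sub>2 x * \<psi> x)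
           = a * (LINT x|?L. u\<^sub>1 x * \<psi> x)"
    by (rule weak_solution_test[OF dom wu]; rule that; assumption)
  obtain H\<^sub>1 H\<^sub>2 where H: "H1_gradient \<Omega> v\<^sub>1 H\<^sub>1" "H1_gradient \<Omega> v\<^sub>2 H\<^sub>2"
    and Ht: "\<And>\<psi> G. H1_gradient \<Omega> \<psi> G \<Longrightarrow> continuous_on (closure \<Omega>) \<psi> \<Longrightarrow>
       (LINT x|?L. H\<^sub>1 x \<bullet> G x) + \<alpha> * (LINT x|surface_measure \<Omega>. v\<^sub>1 x * \<psi> x)
           = (LINT x|?L. (v\<^sub>1 x * v\<^sub>2 x - b * v\<^sub>1 x) * \<psi> x)"
    "\<And>\<psi> G. H1_gradient \<Omega> \<psi> G \<Longrightarrow> continuous_on (closure \<Omega>) \<psi> \<Longrightarrow>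
       (LINT x|?L. H\<^sub>2 x \<bullet> G x) + \<beta> * (LINT x|surface_measure \<Omega>. \<bar>v\<^sub>2 x\<bar> powr (\<gamma> - 2) * v\<^sub>2 x * \<psi> x)
           = a * (LINT x|?L. v\<^sub>1 x * \<psi> x)"
    by (rule weak_solution_test[OF dom wv]; rule that; assumption)
  define w where "w x = u\<^sub>2 x - v\<^sub>2 x" for x
  define \<psi> where "\<psi> x = (max 0 (w x))\<^sup>2" for x
  have cw: "continuous_on (closure \<Omega>) w" unfolding w_def by (intro continuous_intros c)
  have c\<psi>: "continuous_on (closure \<Omega>) \<psi>" unfolding \<psi>_def by (intro continuous_intros cw)
  have \<psi>0: "\<psi> x \<ge> 0" for x unfolding \<psi>_def by simp
  define D where "D x = 1 *\<^sub>R G\<^sub>2 x + (-1) *\<^sub>R H\<^sub>2 x" for x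
  have hw: "H1_gradient \<Omega> w D"
    using H1_gradient_lincomb[OF \<Omega> G(2) H(2), of 1 "-1"] unfolding w_def D_def by simp
  define K where "K x = (2 * max 0 (w x)) *\<^sub>R D x" for x
  have h\<psi>: "H1_gradient \<Omega> \<psi> K" unfolding \<psi>_def K_def
    by (rule H1_gradient_chain_rule[OF \<Omega> cw hw has_real_derivative_positive_part_square])
       (intro continuous_intros)
  \<comment> \<open>Positivity inside \<Omega> passes to the boundary only as nonnegativity, which
    is enough for monotonicity of the boundary nonlinearity.\<close>
  have nn: "0 \<le> u\<^sub>2 x" "0 \<le> v\<^sub>2 x" if "x \<in> closure \<Omega>" for x
    using continuous_ge_on_closure[OF c(2) that, of 0] continuous_ge_on_closure[OF c(4) that, of 0] pos(3,4)
    by (auto intro: less_imp_le)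
  have fr: "frontier \<Omega> \<subseteq> closure \<Omega>" by (auto simp: frontier_def)
  have iS: "integrable ?S (\<lambda>x. \<bar>f x\<bar> powr (\<gamma> - 2) * f x * \<psi> x)"
    if cf: "continuous_on (closure \<Omega>) f" for f
  proof -
    obtain C where C: "\<And>x. x \<in> closure \<Omega> \<Longrightarrow> \<bar>f x\<bar> \<le> C" using bounded_on_closure[OF \<Omega>(2) cf] by metis
    obtain C' where C': "\<And>x. x \<in> closure \<Omega> \<Longrightarrow> \<bar>\<psi> x\<bar> \<le> C'" using bounded_on_closure[OF \<Omega>(2) c\<psi>] by metis
    have [measurable]: "f \<in> borel_measurable ?S" "\<psi> \<in> borel_measurable ?S"
      by (intro measurable_surface_measure continuous_on_subset[OF _ fr] cf c\<psi>)+
    show ?thesis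
    proof (rule finite_measure.integrable_const_bound[OF finite_surface_measure[OF dom]])
      show "(\<lambda>x. \<bar>f x\<bar> powr (\<gamma> - 2) * f x * \<psi> x) \<in> borel_measurable ?S" by measurable
      show "AE x in ?S. norm (\<bar>f x\<bar> powr (\<gamma> - 2) * f x * \<psi> x) \<le> C powr (\<gamma> - 2) * C * C'"
      proof (rule AE_I2)
        fix x assume "x \<in> space ?S"
        then have "x \<in> closure \<Omega>" using fr by auto
        then have "\<bar>f x\<bar> \<le> C" "\<bar>\<psi> x\<bar> \<le> C'" using C C' by auto
        then show "norm (\<bar>f x\<bar> powr (\<gamma> - 2) * f x * \<psi> x) \<le> C powr (\<gamma> - 2) * C * C'"
          using \<gamma> by (auto simp: abs_mult intro!: mult_mono powr_mono2)
      qed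
    qed
  qed
  have bd: "(LINT x|?S. \<bar>v\<^sub>2 x\<bar> powr (\<gamma> - 2) * v\<^sub>2 x * \<psi> x) \<le> (LINT x|?S. \<bar>u\<^sub>2 x\<bar> powr (\<gamma> - 2) * u\<^sub>2 x * \<psi> x)"
  proof (rule integral_mono[OF iS[OF c(4)] iS[OF c(2)]])
    fix x assume "x \<in> space ?S"
    then have x: "x \<in> closure \<Omega>" using fr by auto
    show "\<bar>v\<^sub>2 x\<bar> powr (\<gamma> - 2) * v\<^sub>2 x * \<psi> x \<le> \<bar>u\<^sub>2 x\<bar> powr (\<gamma> - 2) * u\<^sub>2 x * \<psi> x"
    \<comment> \<open>For \<open>w x \<le> 0\<close> both sides vanish with \<psi>. Otherwise the
      nonnegative value \<open>v\<^sub>2 x\<close> is below \<open>u\<^sub>2 x\<close>, and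
      \<open>s powr (\<gamma> - 2) * s\<close> is nondecreasing in \<open>s \<ge> 0\<close> because
      \<open>\<gamma> \<ge> 2\<close>.\<close>
    proof (cases "w x \<le> 0")
      case True
      then show ?thesis unfolding \<psi>_def by simp
    next
      case False
      then have "v\<^sub>2 x \<le> u\<^sub>2 x" unfolding w_def by simp
      then show ?thesis using nn[OF x] \<gamma> \<psi>0[of x]
        by (auto intro!: mult_right_mono mult_mono powr_mono2)
    qed
  qed
  have "(LINT x|?L. u\<^sub>1 x * \<psi> x) \<le> (LINT x|?L. v\<^sub>1 x * \<psi> x)"
    using le \<psi>0 by (intro integral_mono icc continuous_intros c c\<psi> mult_right_mono) auto
  then have "a * (LINT x|?L. u\<^sub>1 x * \<psi> x) \<le> a * (LINT x|?L. v\<^sub>1 x * \<psi> x)" using a by simp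
  moreover have "\<beta> * (LINT x|?S. \<bar>v\<^sub>2 x\<bar> powr (\<gamma> - 2) * v\<^sub>2 x * \<psi> x) \<le> \<beta> * (LINT x|?S. \<bar>u\<^sub>2 x\<bar> powr (\<gamma> - 2) * u\<^sub>2 x * \<psi> x)"
    using bd \<beta> by simp
  \<comment> \<open>For \<open>u\<close> the source is smaller and the boundary term larger than for
    \<open>v\<close>, so its Dirichlet term must be the smaller one.\<close>
  ultimately have "(LINT x|?L. G\<^sub>2 x \<bullet> K x) \<le> (LINT x|?L. H\<^sub>2 x \<bullet> K x)"
    using Gt(2)[OF h\<psi> c\<psi>] Ht(2)[OF h\<psi> c\<psi>] by linarith
  moreover have sq: "square_integrable ?L G\<^sub>2" "square_integrable ?L H\<^sub>2" "square_integrable ?L K" "square_integrable ?L D"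
    using G(2) H(2) h\<psi> hw unfolding H1_gradient_def by blast+
  moreover have "(LINT x|?L. D x \<bullet> K x) = (LINT x|?L. G\<^sub>2 x \<bullet> K x) - (LINT x|?L. H\<^sub>2 x \<bullet> K x)"
    using integrable_inner_square_integrable[OF sq(1,3)] integrable_inner_square_integrable[OF sq(2,3)]
    unfolding D_def by (simp add: inner_diff_left)
  ultimately have "(LINT x|?L. D x \<bullet> K x) \<le> 0" by simp
  moreover have DK: "D x \<bullet> K x = 2 * max 0 (w x) * (D x \<bullet> D x)" for x unfolding K_def by simp
  moreover have DK0: "0 \<le> D x \<bullet> K x" for x unfolding DK by (intro mult_nonneg_nonneg) auto
  ultimately have "(LINT x|?L. D x \<bullet> K x) = 0"
    using Bochner_Integration.integral_nonneg[of ?L "\<lambda>x. D x \<bullet> K x"] by (intro antisym) blast+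
  then have "AE x in ?L. D x \<bullet> K x = 0"
    using integrable_inner_square_integrable[OF sq(4,3)] DK0 by (subst (asm) integral_nonneg_eq_0_iff_AE) auto
  \<comment> \<open>\<open>D x \<bullet> K x\<close> is a nonnegative multiple of the squared norm
    of \<open>D x\<close>; if it is 0, then either the factor \<open>max 0 (w x)\<close> or
    \<open>D x\<close> is 0, and \<open>K x\<close> vanishes in both cases.\<close>
  then have "AE x in ?L. K x = 0"
    by (rule eventually_mono) (auto simp: DK K_def)
  then have h0: "H1_gradient \<Omega> \<psi> (\<lambda>_. 0)" by (rule H1_gradient_AE_zero[OF h\<psi>])
  have hu: "H1_gradient \<Omega> (\<lambda>x. \<psi> x * u\<^sub>1 x) (\<lambda>x. \<psi> x *\<^sub>R G\<^sub>1 x)"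
    by (rule H1_gradient_mult_zero_gradient[OF \<Omega> c\<psi> c(1) h0 G(1)])
  have hv: "H1_gradient \<Omega> (\<lambda>x. \<psi> x * v\<^sub>1 x) (\<lambda>x. \<psi> x *\<^sub>R H\<^sub>1 x)"
    by (rule H1_gradient_mult_zero_gradient[OF \<Omega> c\<psi> c(3) h0 H(1)])
  \<comment> \<open>With crossed test functions both Dirichlet integrands are \<psi> times
    \<open>G\<^sub>1 x \<bullet> H\<^sub>1 x\<close>, and both boundary integrands are \<psi> times
    \<open>u\<^sub>1 x * v\<^sub>1 x\<close>. On the right the terms with \<open>b\<close> cancel
    next.\<close>
  have "(LINT x|?L. (u\<^sub>1 x * u\<^sub>2 x - b * u\<^sub>1 x) * (\<psi> x * v\<^sub>1 x)) = (LINT x|?L. (v\<^sub>1 x * v\<^sub>2 x - b * v\<^sub>1 x) * (\<psi> x * u\<^sub>1 x))"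
    using Gt(1)[OF hv continuous_on_mult[OF c\<psi> c(3)]] Ht(1)[OF hu continuous_on_mult[OF c\<psi> c(1)]]
    by (simp add: inner_commute mult.commute mult.left_commute)
  moreover have "(LINT x|?L. (u\<^sub>1 x * u\<^sub>2 x - b * u\<^sub>1 x) * (\<psi> x * v\<^sub>1 x) - (v\<^sub>1 x * v\<^sub>2 x - b * v\<^sub>1 x) * (\<psi> x * u\<^sub>1 x))
    = (LINT x|?L. (u\<^sub>1 x * u\<^sub>2 x - b * u\<^sub>1 x) * (\<psi> x * v\<^sub>1 x)) - (LINT x|?L. (v\<^sub>1 x * v\<^sub>2 x - b * v\<^sub>1 x) * (\<psi> x * u\<^sub>1 x))"
    by (intro Bochner_Integration.integral_diff icc continuous_intros c c\<psi>)
  ultimately have "(LINT x|?L. (u\<^sub>1 x * u\<^sub>2 x - b * u\<^sub>1 x) * (\<psi> x * v\<^sub>1 x) - (v\<^sub>1 x * v\<^sub>2 x - b * v\<^sub>1 x) * (\<psi> x * u\<^sub>1 x)) = 0"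
    by simp
  moreover have "(\<lambda>x. (u\<^sub>1 x * u\<^sub>2 x - b * u\<^sub>1 x) * (\<psi> x * v\<^sub>1 x) - (v\<^sub>1 x * v\<^sub>2 x - b * v\<^sub>1 x) * (\<psi> x * u\<^sub>1 x))
      = (\<lambda>x. u\<^sub>1 x * v\<^sub>1 x * (\<psi> x * w x))"
    by (auto simp: w_def algebra_simps)
  ultimately have int0: "(LINT x|?L. u\<^sub>1 x * v\<^sub>1 x * (\<psi> x * w x)) = 0" by simp
  \<comment> \<open>The product is the cube of the positive part of \<open>w\<close>, so the
    integrand is nonnegative and its vanishing forces \<open>w x \<le> 0\<close>.\<close>
  have nn: "0 \<le> \<psi> x * w x" for x unfolding \<psi>_def by (simp add: max_def)
  have "u\<^sub>1 x * v\<^sub>1 x * (\<psi> x * w x) = 0"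
  proof (rule continuous_nonneg_integral_zero[OF \<Omega> _ _ int0 x])
    show "continuous_on (closure \<Omega>) (\<lambda>x. u\<^sub>1 x * v\<^sub>1 x * (\<psi> x * w x))" by (intro continuous_intros c c\<psi> cw)
    show "0 \<le> u\<^sub>1 y * v\<^sub>1 y * (\<psi> y * w y)" if "y \<in> \<Omega>" for y
      using pos(1,2)[OF that] nn[of y] by simp
  qed
  then have "\<psi> x * w x = 0" using pos(1,2)[OF x] by simp
  then have "w x \<le> 0" unfolding \<psi>_def by (auto simp: max_def split: if_splits)
  then show ?thesis unfolding w_def by simp
qed

theorem theorem2p2:
  fixes \<Omega> :: "(real ^ 'n) set"
    and a b \<alpha> \<beta> \<gamma> :: real
    and u\<^sub>1 u\<^sub>2 v\<^sub>1 v\<^sub>2 :: "real ^ 'n \<Rightarrow> real"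
  assumes "smooth_bounded_domain \<Omega>"
    and "a > 0" and "b > 0" and "\<alpha> \<ge> 0" and "\<beta> > 0" and "\<gamma> \<ge> 2"
    and "positive_solution \<Omega> a b \<alpha> \<beta> \<gamma> u\<^sub>1 u\<^sub>2"
    and "positive_solution \<Omega> a b \<alpha> \<beta> \<gamma> v\<^sub>1 v\<^sub>2"
    and "(\<forall>x\<in>\<Omega>. u\<^sub>1 x \<le> v\<^sub>1 x) \<or> (\<forall>x\<in>\<Omega>. u\<^sub>2 x \<le> v\<^sub>2 x)"
  shows "(\<forall>x\<in>closure \<Omega>. u\<^sub>1 x = v\<^sub>1 x) \<and> (\<forall>x\<in>closure \<Omega>. u\<^sub>2 x = v\<^sub>2 x)"
proof (rule ordered_second_component[OF assms(1,2,7,8)])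
  fix x assume "x \<in> \<Omega>"
  then show "u\<^sub>2 x \<le> v\<^sub>2 x"
    using assms(9) first_ordered_imp_second_ordered[OF assms(1,2,5-8)] by blast
qed

end
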